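(* Let $\mu_2$ be a non-negative Borel measure on $\mathbb{R}^+=[0,\infty)$ with $M:=\mu_2([0,\infty))\in(0,\infty)$, and let $f\in C(\mathbb{R}^+;(0,\infty))$ be locally Lipschitz continuous, regularly varying at infinity with index $0$, and bounded away from zero (i.e. $\inf_{x\ge0}f(x)>0$). Let $\psi>0$ be a real number. Put $F(x)=\int_1^x \frac{du}{f(u)}$ for $x>0$. Then the unique continuous solution $v$ of $$v'(t)=\int_{[0,t]}\mu_2(ds)f(v(t-s)),\quad t\ge 0;\qquad v(0)=\psi,$$ obeys $$\lim_{t\to\infty}v(t)=\infty,\qquad \lim_{t\to\infty}\frac{v(t)}{F^{-1}(Mt)}=1.$$
   Context: A measurable function $h:\mathbb{R}^+\to(0,\infty)$ is regularly varying at infinity with index $\beta\in\mathbb{R}$ (written $h\in\mathrm{RV}_\infty(\beta)$) if $\lim_{x\to\infty}h(\lambda x)/h(x)=\lambda^\beta$ for all $\lambda>0$. $F$ is strictly increasing; $F^{-1}$ is its inverse function. A solution is a continuous function on $[0,\infty)$ with $v(0)=\psi$ that is locally absolutely continuous and satisfies the differential equation for almost every $t>0$. *)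

theory Defs
  imports "HOL-Analysis.Analysis"
begin

definition regularly_varying :: "(real \<Rightarrow> real) \<Rightarrow> real \<Rightarrow> bool" where
  "regularly_varying h \<beta> \<longleftrightarrow>
     h \<in> borel_measurable (restrict_space borel {0..}) \<and>
     (\<forall>x\<ge>0. 0 < h x) \<and>
     (\<forall>c>0. ((\<lambda>x. h (c * x) / h x) \<longlongrightarrow> c powr \<beta>) at_top)"

definition absolutely_continuous_on_interval :: "real \<Rightarrow> real \<Rightarrow> (real \<Rightarrow> real) \<Rightarrow> bool" where
  "absolutely_continuous_on_interval a b g \<longleftrightarrow>
     (\<forall>\<epsilon>>0. \<exists>\<delta>>0. \<forall>(n::nat) (x :: nat \<Rightarrow> real) (y :: nat \<Rightarrow> real).
        (\<forall>i<n. a \<le> x i \<and> x i \<le> y i \<and> y i \<le> b) \<longrightarrow>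
        disjoint_family_on (\<lambda>i. {x i<..<y i}) {..<n} \<longrightarrow>
        (\<Sum>i<n. y i - x i) < \<delta> \<longrightarrow>
        (\<Sum>i<n. \<bar>g (y i) - g (x i)\<bar>) < \<epsilon>)"

text \<open>The nonlinearity \<open>f\<close> is only meaningful on the nonnegative half-line, so a solution is
  required to take its values there.  Functions on the half-line are represented by total
  functions; only their values at nonnegative arguments matter.\<close>

definition is_solution ::
  "real measure \<Rightarrow> (real \<Rightarrow> real) \<Rightarrow> real \<Rightarrow> (real \<Rightarrow> real) \<Rightarrow> bool" where
  "is_solution \<mu> f \<psi> v \<longleftrightarrow>
     continuous_on {0..} v \<and>
     (\<forall>t\<ge>0. 0 \<le> v t) \<and>
     v 0 = \<psi> \<and>
     (\<forall>T>0. absolutely_continuous_on_interval 0 T v) \<and>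
     (AE t in lborel. 0 < t \<longrightarrow>
        (v has_real_derivative (LINT s:{0..t}|\<mu>. f (v (t - s)))) (at t))"

text \<open>The oriented integral: negative for arguments below 1.\<close>

definition recip_integral :: "(real \<Rightarrow> real) \<Rightarrow> real \<Rightarrow> real" where
  "recip_integral f x = (LBINT u=1..x. 1 / f u)"

end

theory Submission
  imports Defs
begin

text \<open>Integrating the equation gives
  \<open>v t = \<psi> + \<integral> W (t - s) \<mu>(ds)\<close> with \<open>W t = \<integral>\<^sub>0\<^sup>t f (v r) dr\<close> (and \<open>W = 0\<close> on the negative
  half-line). Existence and uniqueness for this integral equation are routine since \<open>f\<close> is locally
  Lipschitz and sublinear. As \<open>f (x) = o(x)\<close>, one has \<open>W (t - a) \<sim> W t\<close> for every fixed \<open>a\<close>, and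
  \<open>\<mu> {0..a} * W (t - a) \<le> v t - \<psi> \<le> M * W t\<close> then gives \<open>v \<sim> M * W\<close>. By the uniform convergence theorem
  \<open>(M * W)' = M * f (v) \<sim> M * f (M * W)\<close>, that is, \<open>F (M * W)\<close> has derivative tending to \<open>M\<close>.
  L'Hospital's rule gives \<open>F (M * W t) \<sim> M * t\<close>, and regular variation of \<open>F\<close> with index 1 allows
  inverting this.\<close>

section \<open>Absolutely continuous functions\<close>

text \<open>As a function of \<open>t\<close>, \<open>W (t - s)\<close> has a kink at
  \<open>t = s\<close>, so \<open>v\<close> may fail to be differentiable at the atoms of \<mu>. The
  equation can therefore hold only almost everywhere, and absolute continuity is what allows it to
  be integrated. Since \<open>f\<close> is not assumed monotone, \<open>f (v t)\<close> cannot be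
  compared directly across a delay; \<open>W\<close> is increasing and has a continuous derivative,
  so the estimates are carried by \<open>W\<close>. The quotient of \<open>v\<close> and
  \<open>M * W\<close> tends to 1 without being constant, so slow variation for each fixed factor
  does not compare \<open>f (v t)\<close> with \<open>f (M * W t)\<close>; uniformity for factors
  near 1 does. In the final inversion, multiplying the argument of \<open>F\<close> by a constant
  slightly above or below 1 changes the value by a definite proportion, which leaves room for the
  error in \<open>F (M * W t) \<sim> M * t\<close>.\<close>

text \<open>In a tagged division fine enough for the derivative, the intervals tagged in the exceptional null set
  lie in an open set of small measure, so absolute continuity controls their total increment.\<close>

lemma absolutely_continuous_zero_derivative_imp_eq:
  assumes ac: "absolutely_continuous_on_interval a b h" and "a \<le> b"
    and deriv: "AE t in lborel. a < t \<longrightarrow> t < b \<longrightarrow> (h has_real_derivative 0) (at t)"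
  shows "h b = h a"
proof -
  have "\<bar>h b - h a\<bar> \<le> \<epsilon>" if "\<epsilon> > 0" for \<epsilon>
  proof -
    \<comment> \<open>Half of \<epsilon> is reserved for the intervals tagged outside the null set,
      whose increments sum to at most \<open>\<eta> * (b - a)\<close>. The \<open>+ 1\<close> covers
      \<open>a = b\<close>.\<close>
    define \<eta> where "\<eta> = \<epsilon> / (2 * (b - a + 1))"
    have "\<eta> > 0" and \<eta>: "\<eta> * (b - a) \<le> \<epsilon> / 2"
      using that \<open>a \<le> b\<close> by (auto simp: \<eta>_def field_simps)
    obtain \<delta> where "\<delta> > 0" and \<delta>: "\<forall>(n::nat) (x :: nat \<Rightarrow> real) (y :: nat \<Rightarrow> real).
        (\<forall>i<n. a \<le> x i \<and> x i \<le> y i \<and> y i \<le> b) \<longrightarrow>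
        disjoint_family_on (\<lambda>i. {x i<..<y i}) {..<n} \<longrightarrow>
        (\<Sum>i<n. y i - x i) < \<delta> \<longrightarrow> (\<Sum>i<n. \<bar>h (y i) - h (x i)\<bar>) < \<epsilon> / 2"
      using ac[unfolded absolutely_continuous_on_interval_def, THEN spec, THEN mp, OF half_gt_zero[OF \<open>\<epsilon> > 0\<close>]]
      by (elim exE conjE)
    obtain N' where N': "{t \<in> space lborel. \<not> (a < t \<longrightarrow> t < b \<longrightarrow> (h has_real_derivative 0) (at t))} \<subseteq> N'"
      "N' \<in> null_sets lborel"
      using deriv by (auto elim!: AE_E simp: null_sets_def)
    \<comment> \<open>The derivative is assumed only inside the open interval, so both endpoints
      count as exceptional tags.\<close>
    define N where "N = N' \<union> {a, b}"
    have N: "N \<in> null_sets lborel"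
      unfolding N_def by (intro null_sets.Un N' finite_imp_null_set_lborel) auto
    then have "N \<in> sets borel" "emeasure lborel N = 0" by auto
    then obtain U where U: "open U" "N \<subseteq> U" "emeasure lborel (U - N) < ennreal \<delta>"
      using outer_regular_lborel[of N \<delta>] \<open>\<delta> > 0\<close> by auto
    have U\<delta>: "emeasure lborel U < ennreal \<delta>"
      using U N \<open>N \<in> sets borel\<close> by (metis emeasure_Diff_null_set sets_lborel borel_open)
    have "\<exists>d>0. \<forall>y. \<bar>y - t\<bar> < d \<longrightarrow> \<bar>h y - h t\<bar> \<le> \<eta> * \<bar>y - t\<bar>" if "t \<notin> N" "a \<le> t" "t \<le> b" for t
    proof -
      have "a < t" "t < b" "t \<notin> N'" using that by (auto simp: N_def less_le)
      then have "(h has_real_derivative 0) (at t)"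
        using N'(1) by auto
      then have "(h has_derivative (\<lambda>x. 0)) (at t)"
        by (simp add: has_field_derivative_def lambda_zero)
      then show ?thesis
        using \<open>\<eta> > 0\<close> by (force simp: has_derivative_at_alt)
    qed
    then obtain d where d: "\<And>t. t \<notin> N \<Longrightarrow> a \<le> t \<Longrightarrow> t \<le> b \<Longrightarrow> d t > 0"
      "\<And>t y. t \<notin> N \<Longrightarrow> a \<le> t \<Longrightarrow> t \<le> b \<Longrightarrow> \<bar>y - t\<bar> < d t \<Longrightarrow> \<bar>h y - h t\<bar> \<le> \<eta> * \<bar>y - t\<bar>"
      by metis
    define \<gamma> where "\<gamma> t = (if t \<in> N then U else ball t (if a \<le> t \<and> t \<le> b then d t else 1))" for t
    have "gauge \<gamma>"
      using d U by (auto simp: gauge_def \<gamma>_def)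
    then obtain p where p: "p tagged_division_of {a..b}" "\<gamma> fine p"
      using fine_division_exists_real by blast
    have "finite p" using p by auto
    have pK: "\<exists>u v. a \<le> u \<and> u \<le> v \<and> v \<le> b \<and> u \<le> x \<and> x \<le> v \<and> K = {u..v} \<and> K \<subseteq> \<gamma> x \<and> Sup K = v \<and> Inf K = u"
      if xKp: "(x, K) \<in> p" for x K
    proof -
      obtain u v where uv: "K = cbox u v" using tagged_division_ofD(4)[OF p(1) xKp] by auto
      have "x \<in> K" "K \<subseteq> {a..b}" using tagged_division_ofD(2,3)[OF p(1) xKp] by auto
      moreover have "K \<subseteq> \<gamma> x" using p xKp by (auto simp: fine_def)
      ultimately show ?thesis using uv by (intro exI[of _ u] exI[of _ v]) auto
    qed
    define g where "g = (\<lambda>(x::real, K). h (Sup K) - h (Inf K))"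
    have "h b - h a = sum g p"
      unfolding g_def using additive_tagged_division_1[OF \<open>a \<le> b\<close> p(1), of h] by simp
    define p1 where "p1 = {q \<in> p. fst q \<in> N}"
    define p2 where "p2 = {q \<in> p. fst q \<notin> N}"
    have "p = p1 \<union> p2" "p1 \<inter> p2 = {}" "finite p1" "finite p2"
      using \<open>finite p\<close> by (auto simp: p1_def p2_def)
    then have sum_split: "sum g p = sum g p1 + sum g p2"
      by (simp add: sum.union_disjoint)
    have g2: "\<bar>g q\<bar> \<le> \<eta> * (Sup (snd q) - Inf (snd q))" if q: "q \<in> p2" for q
    proof -
      obtain x K where xK: "q = (x, K)" "(x, K) \<in> p" "x \<notin> N" using q by (cases q) (auto simp: p2_def)
      obtain u v where uv: "a \<le> u" "v \<le> b" "u \<le> x" "x \<le> v" "K = {u..v}" "K \<subseteq> \<gamma> x" "Sup K = v" "Inf K = u"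
        using pK[OF xK(2)] by blast
      have "u \<in> \<gamma> x" "v \<in> \<gamma> x" using uv by auto
      then have "\<bar>u - x\<bar> < d x" "\<bar>v - x\<bar> < d x"
        using uv xK by (auto simp: \<gamma>_def dist_real_def)
      then have "\<bar>h u - h x\<bar> \<le> \<eta> * (x - u)" "\<bar>h v - h x\<bar> \<le> \<eta> * (v - x)"
        using d(2)[of x u] d(2)[of x v] uv xK by auto
      then have "\<bar>h v - h u\<bar> \<le> \<eta> * (v - u)" by (simp add: algebra_simps)
      then show ?thesis using uv xK by (simp add: g_def)
    qed
    have nonneg: "0 \<le> Sup (snd q) - Inf (snd q)" if "q \<in> p" for q
      using pK[of "fst q" "snd q"] that by auto
    have "\<bar>sum g p2\<bar> \<le> (\<Sum>q\<in>p2. \<eta> * (Sup (snd q) - Inf (snd q)))"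
      by (intro order.trans[OF sum_abs] sum_mono g2)
    also have "\<dots> \<le> (\<Sum>q\<in>p. \<eta> * (Sup (snd q) - Inf (snd q)))"
      using \<open>\<eta> > 0\<close> \<open>finite p\<close> nonneg by (intro sum_mono2) (auto simp: p2_def)
    also have "\<dots> = \<eta> * (\<Sum>(x, K)\<in>p. Sup K - Inf K)"
      by (simp add: sum_distrib_left case_prod_unfold)
    also have "\<dots> = \<eta> * (b - a)"
      using additive_tagged_division_1[OF \<open>a \<le> b\<close> p(1), of "\<lambda>x. x"] by simp
    finally have sum2: "\<bar>sum g p2\<bar> \<le> \<epsilon> / 2" using \<eta> by simp
    \<comment> \<open>Absolute continuity speaks of finite families indexed by natural numbers, so
      the exceptional part of the division is enumerated.\<close>
    obtain e where e: "bij_betw e {..<card p1} p1"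
      using ex_bij_betw_nat_finite[OF \<open>finite p1\<close>] by (auto simp: atLeast0LessThan)
    have e_in: "e i \<in> p1" if "i < card p1" for i using e that by (auto simp: bij_betw_def)
    define x where "x i = Inf (snd (e i))" for i
    define y where "y i = Sup (snd (e i))" for i
    have xy: "a \<le> x i \<and> x i \<le> y i \<and> y i \<le> b \<and> snd (e i) = {x i..y i} \<and> {x i..y i} \<subseteq> U"
      if "i < card p1" for i
    proof -
      have "(fst (e i), snd (e i)) \<in> p" "fst (e i) \<in> N" using e_in[OF that] by (auto simp: p1_def)
      with pK[OF this(1)] show ?thesis by (auto simp: x_def y_def \<gamma>_def)
    qed
    have disj: "disjoint_family_on (\<lambda>i. {x i<..<y i}) {..<card p1}"
    proof (unfold disjoint_family_on_def, intro ballI impI)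
      fix i j assume ij: "i \<in> {..<card p1}" "j \<in> {..<card p1}" "i \<noteq> j"
      then have "e i \<noteq> e j" using e by (auto simp: bij_betw_def inj_on_def)
      then have "interior (snd (e i)) \<inter> interior (snd (e j)) = {}"
        using e_in[of i] e_in[of j] ij tagged_division_ofD(5)[OF p(1), of "fst (e i)" "snd (e i)" "fst (e j)" "snd (e j)"]
        by (auto simp: p1_def prod_eq_iff)
      then show "{x i<..<y i} \<inter> {x j<..<y j} = {}"
        using xy ij by (simp add: interior_atLeastAtMost_real)
    qed
    have "ennreal (\<Sum>i<card p1. y i - x i) = (\<Sum>i<card p1. emeasure lborel {x i<..<y i})"
      using xy by (subst sum_ennreal[symmetric]) (auto intro!: sum.cong)
    also have "\<dots> = emeasure lborel (\<Union>i<card p1. {x i<..<y i})"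
      using disj by (intro sum_emeasure) auto
    also have "\<dots> \<le> emeasure lborel U"
      using xy U by (intro emeasure_mono) (auto, force)
    finally have "(\<Sum>i<card p1. y i - x i) < \<delta>"
      using U\<delta> \<open>\<delta> > 0\<close> by (metis le_less_trans ennreal_leI linorder_not_le)
    then have "(\<Sum>i<card p1. \<bar>h (y i) - h (x i)\<bar>) < \<epsilon> / 2"
      using \<delta>[THEN spec[of _ "card p1"], THEN spec[of _ x], THEN spec[of _ y]] xy disj by blast
    also have "(\<Sum>i<card p1. \<bar>h (y i) - h (x i)\<bar>) = (\<Sum>q\<in>p1. \<bar>g q\<bar>)"
      using sum.reindex_bij_betw[OF e, of "\<lambda>q. \<bar>g q\<bar>"] by (simp add: g_def x_def y_def case_prod_unfold)
    finally have "\<bar>sum g p1\<bar> \<le> \<epsilon> / 2"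
      using sum_abs[of g p1] by linarith
    then show ?thesis
      using sum2 sum_split \<open>h b - h a = sum g p\<close> by linarith
  qed
  then have "\<bar>h b - h a\<bar> \<le> 0" by (rule dense_ge)
  then show ?thesis by simp
qed

lemma absolutely_continuous_diff:
  assumes "absolutely_continuous_on_interval a b g" "absolutely_continuous_on_interval a b h"
  shows "absolutely_continuous_on_interval a b (\<lambda>t. g t - h t)"
  unfolding absolutely_continuous_on_interval_def
proof (intro allI impI)
  fix \<epsilon> :: real assume "\<epsilon> > 0"
  let ?P = "\<lambda>h \<epsilon> \<delta>. \<forall>(n::nat) (x :: nat \<Rightarrow> real) y. (\<forall>i<n. a \<le> x i \<and> x i \<le> y i \<and> y i \<le> b) \<longrightarrow>
      disjoint_family_on (\<lambda>i. {x i<..<y i}) {..<n} \<longrightarrow> (\<Sum>i<n. y i - x i) < \<delta> \<longrightarrow>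
      (\<Sum>i<n. \<bar>h (y i) - h (x i)\<bar>) < \<epsilon>"
  obtain \<delta>1 where 1: "\<delta>1 > 0" "?P g (\<epsilon>/2) \<delta>1"
    using assms(1)[unfolded absolutely_continuous_on_interval_def, THEN spec, THEN mp, OF half_gt_zero[OF \<open>\<epsilon> > 0\<close>]]
    by (elim exE conjE)
  obtain \<delta>2 where 2: "\<delta>2 > 0" "?P h (\<epsilon>/2) \<delta>2"
    using assms(2)[unfolded absolutely_continuous_on_interval_def, THEN spec, THEN mp, OF half_gt_zero[OF \<open>\<epsilon> > 0\<close>]]
    by (elim exE conjE)
  show "\<exists>\<delta>>0. ?P (\<lambda>t. g t - h t) \<epsilon> \<delta>"
  proof (intro exI[of _ "min \<delta>1 \<delta>2"] conjI allI impI)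
    fix n :: nat and x y :: "nat \<Rightarrow> real"
    assume *: "\<forall>i<n. a \<le> x i \<and> x i \<le> y i \<and> y i \<le> b" "disjoint_family_on (\<lambda>i. {x i<..<y i}) {..<n}"
      "(\<Sum>i<n. y i - x i) < min \<delta>1 \<delta>2"
    have "(\<Sum>i<n. \<bar>g (y i) - g (x i)\<bar>) < \<epsilon>/2"
      using 1(2)[THEN spec[of _ n], THEN spec[of _ x], THEN spec[of _ y]] * by simp
    moreover have "(\<Sum>i<n. \<bar>h (y i) - h (x i)\<bar>) < \<epsilon>/2"
      using 2(2)[THEN spec[of _ n], THEN spec[of _ x], THEN spec[of _ y]] * by simp
    moreover have "(\<Sum>i<n. \<bar>(g (y i) - h (y i)) - (g (x i) - h (x i))\<bar>)
        \<le> (\<Sum>i<n. \<bar>g (y i) - g (x i)\<bar> + \<bar>h (y i) - h (x i)\<bar>)"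
      by (intro sum_mono) linarith
    ultimately show "(\<Sum>i<n. \<bar>(g (y i) - h (y i)) - (g (x i) - h (x i))\<bar>) < \<epsilon>"
      by (simp add: sum.distrib)
  qed (use 1(1) 2(1) in auto)
qed

lemma absolutely_continuous_cong:
  assumes "\<And>t. a \<le> t \<Longrightarrow> t \<le> b \<Longrightarrow> g t = h t" "absolutely_continuous_on_interval a b g"
  shows "absolutely_continuous_on_interval a b h"
proof -
  have "(\<Sum>i<n. \<bar>h (y i) - h (x i)\<bar>) = (\<Sum>i<n. \<bar>g (y i) - g (x i)\<bar>)"
    if "\<forall>i<n. a \<le> x i \<and> x i \<le> y i \<and> y i \<le> b" for n :: nat and x y :: "nat \<Rightarrow> real"
  proof (intro sum.cong refl)
    fix i assume "i \<in> {..<n}"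
    then have "h (x i) = g (x i)" "h (y i) = g (y i)"
      using that assms(1)[of "x i"] assms(1)[of "y i"] by force+
    then show "\<bar>h (y i) - h (x i)\<bar> = \<bar>g (y i) - g (x i)\<bar>" by simp
  qed
  then show ?thesis
    using assms(2) unfolding absolutely_continuous_on_interval_def by (simp cong: imp_cong)
qed

section \<open>Smearing a primitive with a measure\<close>

locale delay_measure = finite_measure \<mu> for \<mu> :: "real measure" +
  assumes sets_eq: "sets \<mu> = sets (restrict_space borel {0..})"
begin

lemma space_eq: "space \<mu> = {0..}"
  using sets_eq_imp_space_eq[OF sets_eq] by (simp add: space_restrict_space)

lemma borel_imp_measurable: "g \<in> borel_measurable borel \<Longrightarrow> g \<in> borel_measurable \<mu>"
  unfolding measurable_cong_sets[OF sets_eq refl] by (rule measurable_restrict_space1)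

lemma sets_Icc [simp]: "0 \<le> a \<Longrightarrow> {a..b} \<in> sets \<mu>"
  unfolding sets_eq by (subst sets_restrict_space_iff) auto

lemma sets_singleton [simp]: "0 \<le> a \<Longrightarrow> {a} \<in> sets \<mu>"
  using sets_Icc[of a a] by simp

end

section \<open>Primitives that vanish on the negative half-line\<close>

lemma has_real_derivative_integral_from_0:
  fixes g :: "real \<Rightarrow> real"
  assumes "continuous_on {0..} g" "0 < x"
  shows "((\<lambda>x. integral {0..x} g) has_real_derivative g x) (at x)"
proof -
  have "((\<lambda>u. integral {0..u} g) has_vector_derivative g x) (at x within {0..x+1})"
    by (rule integral_has_vector_derivative) (use assms in \<open>auto intro: continuous_on_subset\<close>)
  then show ?thesis
    using assms at_within_Icc_at[of 0 x "x+1"]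
    by (simp add: has_real_derivative_iff_has_vector_derivative)
qed

lemma integral_from_0_nonpos [simp]: "x \<le> 0 \<Longrightarrow> integral {0..x} g = 0" for x :: real
  by (cases "x = 0") auto

text \<open>Negative \<open>x\<close> and \<open>y\<close> are allowed: the primitive is 0 there, so
  the left end is clipped to 0, which only shortens the interval. This lets \<open>t - s\<close> be
  inserted for delays beyond \<open>t\<close>.\<close>

lemma integral_from_0_Lipschitz:
  fixes g :: "real \<Rightarrow> real"
  assumes g: "continuous_on {0..} g" and B: "\<And>r. 0 \<le> r \<Longrightarrow> r \<le> T \<Longrightarrow> \<bar>g r\<bar> \<le> B" "0 \<le> B"
    and "x \<le> T" "y \<le> T"
  shows "\<bar>integral {0..y} g - integral {0..x} g\<bar> \<le> B * \<bar>y - x\<bar>"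
proof -
  have *: "\<bar>integral {0..y} g - integral {0..x} g\<bar> \<le> B * \<bar>y - x\<bar>" if "x \<le> y" "y \<le> T" for x y
  proof (cases "y \<le> 0")
    case False
    define x' where "x' = max 0 x"
    have x': "integral {0..x} g = integral {0..x'} g" "0 \<le> x'" "x' \<le> y" "y - x' \<le> y - x"
      using that False by (cases "x \<le> 0"; simp add: x'_def)+
    have "integral {0..x'} g + integral {x'..y} g = integral {0..y} g"
      using x' by (intro Henstock_Kurzweil_Integration.integral_combine integrable_continuous_real continuous_on_subset[OF g]) auto
    then have "integral {0..y} g - integral {0..x} g = integral {x'..y} g" using x' by simp
    moreover have "norm (integral {x'..y} g) \<le> B * (y - x')"
      using x' that B by (intro integral_bound continuous_on_subset[OF g]) auto
    moreover have "B * (y - x') \<le> B * (y - x)" using B(2) x' by (intro mult_left_mono) auto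
    ultimately show ?thesis using that by simp
  qed (use that B in auto)
  show ?thesis
    using *[of x y] *[of y x] assms by (cases "x \<le> y") (auto simp: abs_minus_commute)
qed

lemma continuous_on_halfline_bound:
  fixes g :: "real \<Rightarrow> real"
  assumes "continuous_on {0..} g"
  obtains B where "B > 0" "\<And>r. 0 \<le> r \<Longrightarrow> r \<le> T \<Longrightarrow> \<bar>g r\<bar> \<le> B"
proof -
  have "compact (g ` {0..T})"
    by (rule compact_continuous_image[OF continuous_on_subset[OF assms]]) auto
  then obtain B where "B > 0" "\<And>y. y \<in> g ` {0..T} \<Longrightarrow> norm y \<le> B"
    using bounded_pos[of "g ` {0..T}"] compact_imp_bounded by auto
  then show ?thesis by (intro that[of B]) auto
qed

lemma continuous_integral_from_0:
  fixes g :: "real \<Rightarrow> real"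
  assumes g: "continuous_on {0..} g"
  shows "continuous_on S (\<lambda>x. integral {0..x} g)"
proof -
  have "isCont (\<lambda>x. integral {0..x} g) x" for x
  proof -
    obtain B where B: "B > 0" "\<And>r. 0 \<le> r \<Longrightarrow> r \<le> x + 1 \<Longrightarrow> \<bar>g r\<bar> \<le> B"
      using continuous_on_halfline_bound[OF g, of "x + 1"] by metis
    have "B-lipschitz_on {..x+1} (\<lambda>x. integral {0..x} g)"
      using B integral_from_0_Lipschitz[OF g, of "x+1" B]
      by (intro lipschitz_onI) (auto simp: dist_real_def)
    then have "continuous_on {..<x+1} (\<lambda>x. integral {0..x} g)"
      by (rule continuous_on_subset[OF lipschitz_on_continuous_on]) auto
    then show ?thesis by (simp add: continuous_on_eq_continuous_at)
  qed
  then show ?thesis by (simp add: continuous_at_imp_continuous_on)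
qed

text \<open>The integral over \<open>{0..x}\<close> vanishes for negative \<open>x\<close>, so only the delays \<open>s \<le> t\<close> contribute.\<close>

definition (in delay_measure) smear :: "(real \<Rightarrow> real) \<Rightarrow> real \<Rightarrow> real" where
  "smear g t = (LINT s|\<mu>. integral {0..t - s} g)"

context delay_measure
begin

lemma integrable_smear:
  fixes g :: "real \<Rightarrow> real"
  assumes g: "continuous_on {0..} g"
  shows "integrable \<mu> (\<lambda>s. integral {0..t - s} g)"
proof -
  obtain B where B: "B > 0" "\<And>r. 0 \<le> r \<Longrightarrow> r \<le> t \<Longrightarrow> \<bar>g r\<bar> \<le> B"
    using continuous_on_halfline_bound[OF g, of t] by metis
  have "\<bar>integral {0..t - s} g\<bar> \<le> B * \<bar>t\<bar>" if "s \<in> space \<mu>" for s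
  proof (cases "s \<le> t")
    case True
    then have "\<bar>integral {0..t - s} g - integral {0..0} g\<bar> \<le> B * \<bar>t - s - 0\<bar>"
      using B that space_eq by (intro integral_from_0_Lipschitz[OF g, of t]) auto
    also have "\<dots> \<le> B * \<bar>t\<bar>" using B True that space_eq by (intro mult_left_mono) auto
    finally show ?thesis by simp
  qed (use B in auto)
  moreover have "(\<lambda>s. integral {0..t - s} g) \<in> borel_measurable borel"
    by (intro borel_measurable_continuous_onI continuous_on_compose2[OF continuous_integral_from_0[OF g, of UNIV]] continuous_intros) auto
  ultimately show ?thesis
    by (intro integrable_const_bound[of _ "B * \<bar>t\<bar>"] borel_imp_measurable) auto
qed

lemma smear_0 [simp]: "smear g 0 = 0"
proof -
  have "smear g 0 = (LINT s|\<mu>. 0)"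
    unfolding smear_def by (intro Bochner_Integration.integral_cong) (auto simp: space_eq)
  then show ?thesis by simp
qed

text \<open>The Lipschitz constant of the primitive does not depend on the delay, so averaging over
  \<mu> multiplies it by the total mass. Continuity, absolute continuity and the linear bound on
  \<open>smear g\<close> all come from this estimate.\<close>

lemma smear_Lipschitz:
  assumes g: "continuous_on {0..} g" and B: "\<And>r. 0 \<le> r \<Longrightarrow> r \<le> T \<Longrightarrow> \<bar>g r\<bar> \<le> B" "0 \<le> B"
    and "x \<le> T" "y \<le> T"
  shows "\<bar>smear g y - smear g x\<bar> \<le> measure \<mu> (space \<mu>) * B * \<bar>y - x\<bar>"
proof -
  have "smear g y - smear g x = (LINT s|\<mu>. integral {0..y - s} g - integral {0..x - s} g)"
    unfolding smear_def by (intro Bochner_Integration.integral_diff[symmetric] integrable_smear g)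
  also have "\<bar>\<dots>\<bar> \<le> (LINT s|\<mu>. B * \<bar>y - x\<bar>)"
  proof (intro integral_abs_bound[THEN order.trans] integral_mono)
    show "\<bar>integral {0..y - s} g - integral {0..x - s} g\<bar> \<le> B * \<bar>y - x\<bar>" if "s \<in> space \<mu>" for s
      using integral_from_0_Lipschitz[OF g B, of T "x - s" "y - s"] that assms by (auto simp: space_eq)
  qed (auto intro!: integrable_smear g)
  also have "\<dots> = measure \<mu> (space \<mu>) * B * \<bar>y - x\<bar>" by simp
  finally show ?thesis .
qed

lemma continuous_smear:
  assumes g: "continuous_on {0..} g"
  shows "continuous_on S (smear g)"
proof -
  have "isCont (smear g) x" for x
  proof -
    obtain B where B: "B > 0" "\<And>r. 0 \<le> r \<Longrightarrow> r \<le> x + 1 \<Longrightarrow> \<bar>g r\<bar> \<le> B"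
      using continuous_on_halfline_bound[OF g, of "x + 1"] by metis
    have "(measure \<mu> (space \<mu>) * B)-lipschitz_on {..<x+1} (smear g)"
      using B smear_Lipschitz[OF g, of "x+1" B]
      by (intro lipschitz_onI) (auto simp: dist_real_def)
    then show ?thesis using lipschitz_on_continuous_on by (force simp: continuous_on_eq_continuous_at)
  qed
  then show ?thesis by (simp add: continuous_at_imp_continuous_on)
qed

lemma smear_absolutely_continuous:
  assumes g: "continuous_on {0..} g"
  shows "absolutely_continuous_on_interval a b (\<lambda>t. c + smear g t)"
  unfolding absolutely_continuous_on_interval_def
proof (intro allI impI)
  fix \<epsilon> :: real assume "\<epsilon> > 0"
  obtain B where B: "B > 0" "\<And>r. 0 \<le> r \<Longrightarrow> r \<le> b \<Longrightarrow> \<bar>g r\<bar> \<le> B"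
    using continuous_on_halfline_bound[OF g, of b] by metis
  \<comment> \<open>The \<open>+ 1\<close> keeps \<open>C\<close> positive when \<mu> has mass
    zero.\<close>
  define C where "C = measure \<mu> (space \<mu>) * B + 1"
  have "C > 0" using B by (simp add: C_def add_nonneg_pos)
  show "\<exists>\<delta>>0. \<forall>(n::nat) x y. (\<forall>i<n. a \<le> x i \<and> x i \<le> y i \<and> y i \<le> b) \<longrightarrow>
      disjoint_family_on (\<lambda>i. {x i<..<y i}) {..<n} \<longrightarrow> (\<Sum>i<n. y i - x i) < \<delta> \<longrightarrow>
      (\<Sum>i<n. \<bar>(c + smear g (y i)) - (c + smear g (x i))\<bar>) < \<epsilon>"
  proof (intro exI[of _ "\<epsilon> / C"] conjI allI impI)
    fix n :: nat and x y :: "nat \<Rightarrow> real"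
    assume *: "\<forall>i<n. a \<le> x i \<and> x i \<le> y i \<and> y i \<le> b" "(\<Sum>i<n. y i - x i) < \<epsilon> / C"
    have "(\<Sum>i<n. \<bar>(c + smear g (y i)) - (c + smear g (x i))\<bar>) \<le> (\<Sum>i<n. C * (y i - x i))"
    proof (intro sum_mono)
      fix i assume "i \<in> {..<n}"
      then have i: "x i \<le> y i" "y i \<le> b" using * by auto
      then have "\<bar>smear g (y i) - smear g (x i)\<bar> \<le> measure \<mu> (space \<mu>) * B * \<bar>y i - x i\<bar>"
        using B by (intro smear_Lipschitz[OF g]) auto
      also have "\<dots> \<le> C * (y i - x i)" using i by (auto simp: C_def algebra_simps)
      finally show "\<bar>(c + smear g (y i)) - (c + smear g (x i))\<bar> \<le> C * (y i - x i)" by simp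
    qed
    also have "\<dots> = C * (\<Sum>i<n. y i - x i)" by (simp add: sum_distrib_left)
    also have "\<dots> < \<epsilon>" using * \<open>C > 0\<close> by (simp add: field_simps)
    finally show "(\<Sum>i<n. \<bar>(c + smear g (y i)) - (c + smear g (x i))\<bar>) < \<epsilon>" .
  qed (use \<open>C > 0\<close> \<open>\<epsilon> > 0\<close> in auto)
qed

text \<open>Differentiation under the integral by dominated convergence. For the delay
  \<open>s = t\<close> the primitive has the one-sided slopes 0 and \<open>g 0\<close>; every other
  delay gives a two-sided derivative, so the only condition is that this single delay carries no
  mass.\<close>

lemma DERIV_smear:
  assumes g: "continuous_on {0..} g" and t: "0 < t" "measure \<mu> {t} = 0"
  shows "(smear g has_real_derivative (LINT s:{0..t}|\<mu>. g (t - s))) (at t)"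
  unfolding DERIV_def tendsto_at_iff_sequentially comp_def
proof (intro allI impI)
  fix X :: "nat \<Rightarrow> real"
  assume X: "\<forall>i. X i \<in> UNIV - {0}" "X \<longlonglongrightarrow> 0"
  \<comment> \<open>Once \<open>X n\<close> is below 1 in absolute value, all arguments stay below
    \<open>t + 1\<close>, where \<open>B\<close> bounds \<open>g\<close> and hence the difference
    quotients.\<close>
  obtain N where N: "\<And>n. n \<ge> N \<Longrightarrow> \<bar>X n\<bar> < 1"
    using X(2) LIMSEQ_D[of X 0 1] by auto
  obtain B where B: "B > 0" "\<And>r. 0 \<le> r \<Longrightarrow> r \<le> t + 1 \<Longrightarrow> \<bar>g r\<bar> \<le> B"
    using continuous_on_halfline_bound[OF g, of "t + 1"] by metis
  define q where "q n s = (integral {0..t + X n - s} g - integral {0..t - s} g) / X n" for n s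
  \<comment> \<open>\<open>g\<close> is controlled only on the half-line; \<open>max 0\<close> gives
    a continuous total function, and the indicator hides the part that was altered.\<close>
  have gc: "continuous_on UNIV (\<lambda>s. g (max 0 (t - s)))"
    by (intro continuous_on_compose2[OF g] continuous_intros) auto
  have m: "q n \<in> borel_measurable \<mu>" for n
    unfolding q_def by (intro borel_measurable_divide borel_measurable_diff borel_measurable_integrable[OF integrable_smear[OF g]]) auto
  have m': "(\<lambda>s. indicator {0..t} s * g (t - s)) \<in> borel_measurable \<mu>"
  proof -
    have "(\<lambda>s. indicator {0..t} s * g (max 0 (t - s))) \<in> borel_measurable \<mu>"
      using gc by (intro borel_imp_measurable borel_measurable_times borel_measurable_continuous_onI[OF gc] borel_measurable_indicator) auto
    moreover have "(\<lambda>s. indicator {0..t} s * g (max 0 (t - s))) = (\<lambda>s. indicator {0..t} s * g (t - s))"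
      by (auto simp: indicator_def max_def)
    ultimately show ?thesis by simp
  qed
  have "(\<lambda>n. LINT s|\<mu>. q (n + N) s) \<longlonglongrightarrow> (LINT s|\<mu>. indicator {0..t} s * g (t - s))"
  proof (rule integral_dominated_convergence[where w = "\<lambda>_. B"])
    have "AE s in \<mu>. s \<notin> {t}"
      using t by (intro AE_not_in) (auto simp: null_sets_def emeasure_eq_measure)
    then show "AE s in \<mu>. (\<lambda>n. q (n + N) s) \<longlonglongrightarrow> indicator {0..t} s * g (t - s)"
    proof (rule AE_mp, intro AE_I2 impI)
      fix s assume "s \<in> space \<mu>" "s \<notin> {t}"
      then have s: "0 \<le> s" "s \<noteq> t" by (auto simp: space_eq)
      have "((\<lambda>x. integral {0..x} g) has_real_derivative indicator {0..t} s * g (t - s)) (at (t - s))"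
      proof (cases "s < t")
        case True
        then show ?thesis using has_real_derivative_integral_from_0[OF g, of "t - s"] s by simp
      next
        case False
        have "((\<lambda>x. 0) has_real_derivative 0) (at (t - s))" by simp
        then have "((\<lambda>x. integral {0..x} g) has_real_derivative 0) (at (t - s))"
          by (rule has_field_derivative_transform_within_open[of _ _ _ "{..<0}"]) (use False s in auto)
        then show ?thesis using False s by simp
      qed
      moreover have "q n s = (integral {0..t - s + X n} g - integral {0..t - s} g) / X n" for n
        unfolding q_def by (intro arg_cong2[of _ _ _ _ "(/)"] arg_cong2[of _ _ _ _ "(-)"]
            arg_cong[of _ _ "\<lambda>x. integral {0..x} g"]) simp_all
      ultimately have "(\<lambda>n. q n s) \<longlonglongrightarrow> indicator {0..t} s * g (t - s)"
        using X unfolding DERIV_def tendsto_at_iff_sequentially comp_def by simp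
      then show "(\<lambda>n. q (n + N) s) \<longlonglongrightarrow> indicator {0..t} s * g (t - s)"
        by (rule LIMSEQ_ignore_initial_segment)
    qed
    show "AE s in \<mu>. norm (q (n + N) s) \<le> B" for n
    proof (intro AE_I2)
      fix s assume s: "s \<in> space \<mu>"
      have "\<bar>X (n + N)\<bar> < 1" "X (n + N) \<noteq> 0" using N[of "n + N"] X by auto
      then have "\<bar>integral {0..t + X (n + N) - s} g - integral {0..t - s} g\<bar> \<le> B * \<bar>(t + X (n + N) - s) - (t - s)\<bar>"
        using B s space_eq by (intro integral_from_0_Lipschitz[OF g, of "t+1"]) auto
      then show "norm (q (n + N) s) \<le> B"
        using \<open>X (n + N) \<noteq> 0\<close> by (simp add: q_def field_simps)
    qed
  qed (use m m' in auto)
  then have "(\<lambda>n. LINT s|\<mu>. q n s) \<longlonglongrightarrow> (LINT s|\<mu>. indicator {0..t} s * g (t - s))"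
    by (rule LIMSEQ_offset)
  moreover have "(LINT s|\<mu>. q n s) = (smear g (t + X n) - smear g t) / X n" for n
    unfolding q_def smear_def
    by (simp add: integrable_smear g)
  ultimately show "(\<lambda>n. (smear g (t + X n) - smear g t) / X n) \<longlonglongrightarrow> (LINT s:{0..t}|\<mu>. g (t - s))"
    by (simp add: set_lebesgue_integral_def)
qed

end

section \<open>The integral equation\<close>

lemma continuous_on_comp_nonneg:
  fixes f v :: "real \<Rightarrow> real"
  assumes "continuous_on {0..} f" "continuous_on {0..} v" "\<And>t. 0 \<le> t \<Longrightarrow> 0 \<le> v t"
  shows "continuous_on {0..} (\<lambda>r. f (v r))"
  by (rule continuous_on_compose2[OF assms(1,2)]) (use assms(3) in auto)

context delay_measure
begin

text \<open>A finite measure has at most countably many atoms; off this Lebesgue null set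
  \<open>DERIV_smear\<close> applies.\<close>

lemma AE_not_atom: "AE t in lborel. measure \<mu> {t} = 0"
proof (rule AE_I')
  show "{t. measure \<mu> {t} \<noteq> 0} \<in> null_sets lborel"
    by (rule countable_imp_null_set_lborel[OF countable_support])
qed auto

text \<open>The difference of the two sides is absolutely continuous with derivative zero almost
  everywhere, hence constant; a singular term of Cantor type is thereby excluded. At 0 the
  difference vanishes.\<close>

lemma is_solution_imp_integral_equation:
  assumes f: "continuous_on {0..} f" and v: "is_solution \<mu> f \<psi> v" and "0 \<le> T"
  shows "v T = \<psi> + smear (\<lambda>r. f (v r)) T"
proof (cases "T = 0")
  case False
  let ?g = "\<lambda>r. f (v r)"
  have vc: "continuous_on {0..} v" and v0: "\<And>t. 0 \<le> t \<Longrightarrow> 0 \<le> v t" and "v 0 = \<psi>"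
    and ac: "absolutely_continuous_on_interval 0 T v"
    and D: "AE t in lborel. 0 < t \<longrightarrow> (v has_real_derivative (LINT s:{0..t}|\<mu>. f (v (t - s)))) (at t)"
    using v False \<open>0 \<le> T\<close> by (auto simp: is_solution_def)
  have g: "continuous_on {0..} ?g" by (rule continuous_on_comp_nonneg[OF f vc v0])
  define h where "h t = v t - (\<psi> + smear ?g t)" for t
  have "h T = h 0"
  proof (rule absolutely_continuous_zero_derivative_imp_eq[where h = h and a = 0 and b = T])
    show "absolutely_continuous_on_interval 0 T h"
      unfolding h_def by (intro absolutely_continuous_diff ac smear_absolutely_continuous g)
    show "AE t in lborel. 0 < t \<longrightarrow> t < T \<longrightarrow> (h has_real_derivative 0) (at t)"
      using AE_not_atom D
    proof eventually_elim
      case (elim t)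
      show ?case
      proof (intro impI)
        assume "0 < t" "t < T"
        then have "(v has_real_derivative (LINT s:{0..t}|\<mu>. f (v (t - s)))) (at t)"
          "(smear ?g has_real_derivative (LINT s:{0..t}|\<mu>. f (v (t - s)))) (at t)"
          using elim DERIV_smear[OF g, of t] by auto
        then show "(h has_real_derivative 0) (at t)"
          unfolding h_def by (auto intro!: derivative_eq_intros)
      qed
    qed
  qed (use \<open>0 \<le> T\<close> in auto)
  then show ?thesis using \<open>v 0 = \<psi>\<close> by (simp add: h_def)
qed (use v in \<open>simp add: is_solution_def\<close>)

text \<open>Lipschitz continuity of \<open>smear\<close> on bounded intervals gives absolute
  continuity, and the derivative exists at every positive time that is not an atom of \<mu>.\<close>

lemma integral_equation_imp_is_solution:
  assumes f: "continuous_on {0..} f" and v: "continuous_on {0..} v" "\<And>t. 0 \<le> t \<Longrightarrow> 0 \<le> v t"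
    and eq: "\<And>t. 0 \<le> t \<Longrightarrow> v t = \<psi> + smear (\<lambda>r. f (v r)) t"
  shows "is_solution \<mu> f \<psi> v"
proof -
  let ?g = "\<lambda>r. f (v r)"
  have g: "continuous_on {0..} ?g" by (rule continuous_on_comp_nonneg[OF f v])
  have "absolutely_continuous_on_interval 0 T v" for T
    by (rule absolutely_continuous_cong[OF _ smear_absolutely_continuous[OF g, of _ _ \<psi>]]) (simp add: eq)
  moreover have "AE t in lborel. 0 < t \<longrightarrow>
        (v has_real_derivative (LINT s:{0..t}|\<mu>. f (v (t - s)))) (at t)"
    using AE_not_atom
  proof eventually_elim
    case (elim t)
    show ?case
    proof
      assume "0 < t"
      then have "((\<lambda>t. \<psi> + smear ?g t) has_real_derivative (LINT s:{0..t}|\<mu>. f (v (t - s)))) (at t)"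
        using elim DERIV_smear[OF g, of t] by (auto intro!: derivative_eq_intros)
      then show "(v has_real_derivative (LINT s:{0..t}|\<mu>. f (v (t - s)))) (at t)"
        by (rule has_field_derivative_transform_within_open[of _ _ _ "{0<..}"])
          (use \<open>0 < t\<close> in \<open>auto simp: eq[symmetric]\<close>)
    qed
  qed
  ultimately show ?thesis using v eq[of 0] by (simp add: is_solution_def)
qed

lemma smear_cong:
  assumes "\<And>r. 0 \<le> r \<Longrightarrow> r \<le> t \<Longrightarrow> g r = h r"
  shows "smear g t = smear h t"
  unfolding smear_def
  by (intro Bochner_Integration.integral_cong refl Henstock_Kurzweil_Integration.integral_cong assms)
    (auto simp: space_eq)

text \<open>The integrand on the right is nonnegative, so each upper limit \<open>t - s\<close> can
  be raised to \<open>t\<close>. The delays disappear and an inequality of ordinary Gronwall type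
  remains.\<close>

lemma smear_diff_le:
  assumes g: "continuous_on {0..} g" and h: "continuous_on {0..} h"
  shows "\<bar>smear g t - smear h t\<bar> \<le> measure \<mu> (space \<mu>) * integral {0..t} (\<lambda>r. \<bar>g r - h r\<bar>)"
proof -
  have d: "continuous_on {0..} (\<lambda>r. \<bar>g r - h r\<bar>)" by (intro continuous_intros g h)
  have int: "p integrable_on {0..x}" if "continuous_on {0..} p" for p :: "real \<Rightarrow> real" and x
    by (intro integrable_continuous_real continuous_on_subset[OF that]) auto
  have "smear g t - smear h t = (LINT s|\<mu>. integral {0..t - s} g - integral {0..t - s} h)"
    unfolding smear_def by (simp add: integrable_smear g h)
  also have "\<bar>\<dots>\<bar> \<le> (LINT s|\<mu>. integral {0..t} (\<lambda>r. \<bar>g r - h r\<bar>))"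
  proof (intro integral_abs_bound[THEN order.trans] integral_mono)
    fix s assume s: "s \<in> space \<mu>"
    have "integral {0..t - s} g - integral {0..t - s} h = integral {0..t - s} (\<lambda>r. g r - h r)"
      by (simp add: Henstock_Kurzweil_Integration.integral_diff int g h)
    also have "\<bar>\<dots>\<bar> \<le> integral {0..t - s} (\<lambda>r. \<bar>g r - h r\<bar>)"
      using Henstock_Kurzweil_Integration.integral_norm_bound_integral[of "\<lambda>r. g r - h r" "{0..t - s}" "\<lambda>r. \<bar>g r - h r\<bar>"]
      by (simp add: int d g h continuous_on_diff)
    also have "\<dots> \<le> integral {0..t} (\<lambda>r. \<bar>g r - h r\<bar>)"
      by (rule integral_subset_le) (use s in \<open>auto intro!: int d simp: space_eq\<close>)
    finally show "\<bar>integral {0..t - s} g - integral {0..t - s} h\<bar> \<le> integral {0..t} (\<lambda>r. \<bar>g r - h r\<bar>)" .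
  qed (auto intro!: integrable_smear g h)
  finally show ?thesis by simp
qed

lemma smear_le:
  assumes g: "continuous_on {0..} g" and "\<And>r. 0 \<le> r \<Longrightarrow> 0 \<le> g r"
  shows "smear g t \<le> measure \<mu> (space \<mu>) * integral {0..t} g"
proof -
  have "smear (\<lambda>_. 0) t = 0" by (simp add: smear_def)
  moreover have "integral {0..t} (\<lambda>r. \<bar>g r - 0\<bar>) = integral {0..t} g"
    using assms by (intro Henstock_Kurzweil_Integration.integral_cong) auto
  ultimately show ?thesis using smear_diff_le[OF g continuous_on_const[of _ 0], of t] by simp
qed

text \<open>Delays beyond \<open>a\<close> contribute something nonnegative and are dropped; for the
  others \<open>t - s\<close> is at least \<open>t - a\<close>. The shift is thus fixed, while the
  lost mass can be made small by the choice of \<open>a\<close>.\<close>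

lemma smear_ge:
  assumes g: "continuous_on {0..} g" and nn: "\<And>r. 0 \<le> r \<Longrightarrow> 0 \<le> g r" and "0 \<le> a"
  shows "measure \<mu> {0..a} * integral {0..t - a} g \<le> smear g t"
proof -
  have int: "g integrable_on {0..x}" for x
    by (intro integrable_continuous_real continuous_on_subset[OF g]) auto
  have "(LINT s|\<mu>. indicator {0..a} s * integral {0..t - a} g) \<le> smear g t"
    unfolding smear_def
  proof (intro integral_mono)
    fix s assume s: "s \<in> space \<mu>"
    show "indicator {0..a} s * integral {0..t - a} g \<le> integral {0..t - s} g"
    proof (cases "s \<le> a")
      case True
      have "integral {0..t - a} g \<le> integral {0..t - s} g"
        by (rule integral_subset_le) (use s True nn in \<open>auto intro!: int simp: space_eq\<close>)
      then show ?thesis using s True by (simp add: space_eq)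
    next
      case False
      have "0 \<le> integral {0..t - s} g"
        by (rule Henstock_Kurzweil_Integration.integral_nonneg[OF int]) (use nn in auto)
      then show ?thesis using False by simp
    qed
  qed (auto intro!: integrable_smear g simp: \<open>0 \<le> a\<close> emeasure_eq_measure)
  then show ?thesis using \<open>0 \<le> a\<close> by simp
qed

lemma smear_nonneg:
  assumes g: "continuous_on {0..} g" and nn: "\<And>r. 0 \<le> r \<Longrightarrow> 0 \<le> g r"
  shows "0 \<le> smear g t"
proof -
  have "0 \<le> integral {0..t - 0} g"
    using nn by (intro Henstock_Kurzweil_Integration.integral_nonneg integrable_continuous_real continuous_on_subset[OF g]) auto
  then have "0 \<le> measure \<mu> {0..0} * integral {0..t - 0} g" by simp
  also have "\<dots> \<le> smear g t" by (rule smear_ge[OF g nn]) auto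
  finally show ?thesis .
qed

end

section \<open>Gronwall's inequality, uniqueness and existence\<close>

lemma integral_exp:
  fixes a t :: real
  assumes "a > 0" "0 \<le> t"
  shows "integral {0..t} (\<lambda>r. exp (a * r)) = (exp (a * t) - 1) / a"
proof -
  have "((\<lambda>r. exp (a * r)) has_integral (exp (a * t) / a - exp (a * 0) / a)) {0..t}"
    using assms by (intro fundamental_theorem_of_calculus)
      (auto intro!: derivative_eq_intros simp flip: has_real_derivative_iff_has_vector_derivative)
  then show ?thesis by (simp add: integral_unique diff_divide_distrib)
qed

text \<open>Maximising \<open>exp (- a * t) * D t\<close> for large \<open>a\<close> lets the integral term be absorbed, at the
  cost of the non-sharp constants.\<close>

lemma gronwall:
  fixes D :: "real \<Rightarrow> real"
  assumes D: "continuous_on {0..T} D" and "0 \<le> A" "0 \<le> B" "0 \<le> t" "t \<le> T"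
    and le: "\<And>t. 0 \<le> t \<Longrightarrow> t \<le> T \<Longrightarrow> D t \<le> A + B * integral {0..t} D"
  shows "D t \<le> 2 * A * exp ((2 * B + 1) * t)"
proof -
  \<comment> \<open>This weight gives \<open>B / a \<le> 1 / 2\<close>, so a positive weighted
    maximum \<open>S\<close> satisfies \<open>S \<le> A + S / 2\<close>. The \<open>+ 1\<close>
    keeps \<open>a\<close> positive for \<open>B = 0\<close>.\<close>
  define a where "a = 2 * B + 1"
  have "a > 0" using \<open>0 \<le> B\<close> by (simp add: a_def)
  have "\<exists>x\<in>{0..T}. \<forall>y\<in>{0..T}. exp (- a * y) * D y \<le> exp (- a * x) * D x"
    using assms(4,5) by (intro continuous_attains_sup continuous_intros D) auto
  then obtain x where x: "0 \<le> x" "x \<le> T"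
    "\<And>y. 0 \<le> y \<Longrightarrow> y \<le> T \<Longrightarrow> exp (- a * y) * D y \<le> exp (- a * x) * D x" by auto
  define S where "S = exp (- a * x) * D x"
  have S: "D y \<le> S * exp (a * y)" if "0 \<le> y" "y \<le> T" for y
    using x(3)[OF that] unfolding S_def[symmetric] by (simp add: exp_minus field_simps)
  have Dx: "D x = S * exp (a * x)" by (simp add: S_def exp_minus field_simps)
  have "S \<le> 2 * A"
  proof (cases "S \<le> 0")
    case False
    have "D x \<le> A + B * integral {0..x} D" using le x by simp
    also have "integral {0..x} D \<le> integral {0..x} (\<lambda>r. S * exp (a * r))"
      using S x by (intro integral_le integrable_continuous_real continuous_on_subset[OF D] continuous_intros) auto
    also have "\<dots> = S * ((exp (a * x) - 1) / a)"
      using integral_exp[OF \<open>a > 0\<close> x(1)] by simp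
    also have "\<dots> \<le> S * (exp (a * x) / a)"
      using False \<open>a > 0\<close> by (intro mult_left_mono divide_right_mono) auto
    finally have "D x \<le> A + B * (S * (exp (a * x) / a))"
      using \<open>0 \<le> B\<close> by (simp add: mult_left_mono)
    also have "A \<le> A * exp (a * x)"
      using \<open>0 \<le> A\<close> \<open>a > 0\<close> x by (simp add: mult_le_cancel_left1)
    finally have "S * exp (a * x) \<le> (A + S * (B / a)) * exp (a * x)"
      by (simp add: Dx algebra_simps)
    then have "S \<le> A + S * (B / a)" by simp
    moreover have "S * (B / a) \<le> S * (1 / 2)"
      using False \<open>0 \<le> B\<close> \<open>a > 0\<close> by (intro mult_left_mono) (auto simp: a_def field_simps)
    ultimately show ?thesis by linarith
  qed (use \<open>0 \<le> A\<close> in auto)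
  then have "S * exp (a * t) \<le> 2 * A * exp (a * t)" by simp
  with S[of t] assms(4,5) have "D t \<le> 2 * A * exp (a * t)" by linarith
  then show ?thesis by (simp add: a_def)
qed

context delay_measure
begin

text \<open>Up to \<open>T\<close> both functions stay in a compact interval, where \<open>f\<close>
  is Lipschitz, and Gronwall's inequality applies with \<open>A = 0\<close>. The equation is assumed
  only up to \<open>T\<close>, so that solutions obtained on different intervals can be
  compared.\<close>

lemma integral_equation_unique:
  assumes f: "continuous_on {0..} f" "local_lipschitz (UNIV :: real set) {0..} (\<lambda>_. f)"
    and v: "continuous_on {0..} v" "\<And>t. 0 \<le> t \<Longrightarrow> 0 \<le> v t"
    and w: "continuous_on {0..} w" "\<And>t. 0 \<le> t \<Longrightarrow> 0 \<le> w t"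
    and v_eq: "\<And>t. 0 \<le> t \<Longrightarrow> t \<le> T \<Longrightarrow> v t = \<psi> + smear (\<lambda>r. f (v r)) t"
    and w_eq: "\<And>t. 0 \<le> t \<Longrightarrow> t \<le> T \<Longrightarrow> w t = \<psi> + smear (\<lambda>r. f (w r)) t"
    and t: "0 \<le> t" "t \<le> T"
  shows "v t = w t"
proof -
  obtain B1 where B1: "\<And>r. 0 \<le> r \<Longrightarrow> r \<le> T \<Longrightarrow> \<bar>v r\<bar> \<le> B1"
    using continuous_on_halfline_bound[OF v(1), of T] by metis
  obtain B2 where B2: "\<And>r. 0 \<le> r \<Longrightarrow> r \<le> T \<Longrightarrow> \<bar>w r\<bar> \<le> B2"
    using continuous_on_halfline_bound[OF w(1), of T] by metis
  define K where "K = max B1 B2"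
  have K: "v r \<in> {0..K}" "w r \<in> {0..K}" if "0 \<le> r" "r \<le> T" for r
    using B1[OF that] B2[OF that] v(2) w(2) that by (auto simp: K_def)
  obtain L where "L-lipschitz_on {0..K} f"
    using local_lipschitz_compact_implies_lipschitz[where X = "{0..K}" and T = "{0}" and f = "\<lambda>_. f"]
      local_lipschitz_subset[OF f(2), of "{0}" "{0..K}"] by auto
  then have L: "L \<ge> 0" "\<And>x y. x \<in> {0..K} \<Longrightarrow> y \<in> {0..K} \<Longrightarrow> \<bar>f x - f y\<bar> \<le> L * \<bar>x - y\<bar>"
    by (auto simp: lipschitz_on_def dist_real_def)
  let ?M = "measure \<mu> (space \<mu>)"
  have gv: "continuous_on {0..} (\<lambda>r. f (v r))" and gw: "continuous_on {0..} (\<lambda>r. f (w r))"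
    by (rule continuous_on_comp_nonneg[OF f(1) v], assumption, rule continuous_on_comp_nonneg[OF f(1) w])
  have sub: "continuous_on {0..x} p" if "continuous_on {0..} p" for p :: "real \<Rightarrow> real" and x
    by (rule continuous_on_subset[OF that]) auto
  have "\<bar>v t - w t\<bar> \<le> 2 * 0 * exp ((2 * (?M * L) + 1) * t)"
  proof (rule gronwall[where T = T and D = "\<lambda>t. \<bar>v t - w t\<bar>"])
    fix t assume t: "0 \<le> t" "t \<le> T"
    have "\<bar>v t - w t\<bar> = \<bar>smear (\<lambda>r. f (v r)) t - smear (\<lambda>r. f (w r)) t\<bar>"
      using v_eq[OF t] w_eq[OF t] by simp
    also have "\<dots> \<le> ?M * integral {0..t} (\<lambda>r. \<bar>f (v r) - f (w r)\<bar>)"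
      by (rule smear_diff_le[OF gv gw])
    also have "\<dots> \<le> ?M * integral {0..t} (\<lambda>r. L * \<bar>v r - w r\<bar>)"
      using K L t by (intro mult_left_mono integral_le integrable_continuous_real continuous_intros sub gv gw v w) auto
    finally show "\<bar>v t - w t\<bar> \<le> 0 + ?M * L * integral {0..t} (\<lambda>r. \<bar>v r - w r\<bar>)" by simp
  qed (use L t in \<open>auto intro!: continuous_intros sub v w\<close>)
  then show ?thesis by simp
qed

text \<open>Banach's fixed point theorem for \<open>u t = exp (- a * t) * v t\<close>: the weight makes the map a contraction
  on the whole half-line.\<close>

lemma integral_equation_exists_bounded_Lipschitz:
  assumes g: "\<And>x y. \<bar>g x - g y\<bar> \<le> L * \<bar>x - y\<bar>" "0 \<le> L" and B: "\<And>x. \<bar>g x\<bar> \<le> B"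
  obtains v where "continuous_on UNIV v" "\<And>t. 0 \<le> t \<Longrightarrow> v t = \<psi> + smear (\<lambda>r. g (v r)) t"
proof -
  let ?M = "measure \<mu> (space \<mu>)"
  \<comment> \<open>With this weight the contraction factor \<open>?M * L / a\<close> is at most
    1/2. The summand 1 gives \<open>a \<ge> 1\<close>, hence \<open>t \<le> exp (a * t)\<close>,
    which keeps the weighted image bounded.\<close>
  define a where "a = 2 * ?M * L + 1"
  have a: "a \<ge> 1" using g(2) by (simp add: a_def)
  have "0 \<le> B" using B[of 0] by linarith
  have gc: "continuous_on UNIV g"
    using g by (intro lipschitz_on_continuous_on[of L] lipschitz_onI) (auto simp: dist_real_def)
  define h where "h u r = g (exp (a * r) * apply_bcontfun u r)" for u r
  have h: "continuous_on S (h u)" for S u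
    unfolding h_def by (intro continuous_on_compose2[OF gc] continuous_intros) auto
  \<comment> \<open>\<open>max 0\<close> continues the image constantly to the left, because the
    space of bounded continuous functions used here lives on the whole line.\<close>
  define \<Phi> where "\<Phi> u t = exp (- a * max 0 t) * (\<psi> + smear (h u) (max 0 t))" for u t
  have smear_bound: "\<bar>smear (h u) t\<bar> \<le> ?M * B * t" if "0 \<le> t" for u t
    using smear_Lipschitz[OF h, of t u B 0 t] B \<open>0 \<le> B\<close> that by (auto simp: h_def)
  have "\<Phi> u \<in> bcontfun" for u
  proof (rule bcontfun_normI[where b = "\<bar>\<psi>\<bar> + ?M * B"])
    show "continuous_on UNIV (\<Phi> u)"
      unfolding \<Phi>_def by (intro continuous_intros continuous_on_compose2[OF continuous_smear[OF h, of UNIV]]) auto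
    fix t :: real
    define t' where "t' = max 0 t"
    have "t' \<ge> 0" by (simp add: t'_def)
    have "t' \<le> a * t'" using a \<open>t' \<ge> 0\<close> by (simp add: mult_le_cancel_right1)
    then have t': "t' \<le> exp (a * t')" using exp_ge_add_one_self[of "a * t'"] by linarith
    have "\<bar>\<psi> + smear (h u) t'\<bar> \<le> \<bar>\<psi>\<bar> + ?M * B * t'"
      using smear_bound[OF \<open>t' \<ge> 0\<close>, of u] by linarith
    also have "\<bar>\<psi>\<bar> \<le> \<bar>\<psi>\<bar> * exp (a * t')"
      using a \<open>t' \<ge> 0\<close> by (simp add: mult_le_cancel_left1)
    also have "?M * B * t' \<le> ?M * B * exp (a * t')"
      using t' \<open>0 \<le> B\<close> by (intro mult_left_mono) auto
    finally have "\<bar>\<psi> + smear (h u) t'\<bar> \<le> (\<bar>\<psi>\<bar> + ?M * B) * exp (a * t')"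
      by (simp add: algebra_simps)
    then show "norm (\<Phi> u t) \<le> \<bar>\<psi>\<bar> + ?M * B"
      unfolding \<Phi>_def t'_def[symmetric] by (simp add: abs_mult exp_minus field_simps)
  qed
  then have app: "apply_bcontfun (Bcontfun (\<Phi> u)) = \<Phi> u" for u
    by (simp add: Bcontfun_inverse)
  have "dist (Bcontfun (\<Phi> u)) (Bcontfun (\<Phi> w)) \<le> 1/2 * dist u w" for u w
  proof (rule dist_bound)
    fix t :: real
    define t' where "t' = max 0 t"
    have "t' \<ge> 0" by (simp add: t'_def)
    have hd: "\<bar>h u r - h w r\<bar> \<le> L * dist u w * exp (a * r)" for r
    proof -
      have "\<bar>h u r - h w r\<bar> \<le> L * \<bar>exp (a * r) * u r - exp (a * r) * w r\<bar>"
        unfolding h_def by (rule g)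
      also have "\<dots> = L * (exp (a * r) * dist (u r) (w r))"
        by (simp add: dist_real_def abs_mult flip: right_diff_distrib)
      also have "\<dots> \<le> L * (exp (a * r) * dist u w)"
        using g(2) by (intro mult_left_mono dist_bounded) auto
      finally show ?thesis by (simp add: mult_ac)
    qed
    have "\<bar>smear (h u) t' - smear (h w) t'\<bar> \<le> ?M * integral {0..t'} (\<lambda>r. \<bar>h u r - h w r\<bar>)"
      by (rule smear_diff_le) (rule h)+
    also have "\<dots> \<le> ?M * integral {0..t'} (\<lambda>r. L * dist u w * exp (a * r))"
      using hd by (intro mult_left_mono integral_le integrable_continuous_real continuous_intros h) auto
    also have "\<dots> = ?M * L * dist u w * ((exp (a * t') - 1) / a)"
      using integral_exp[of a t'] a \<open>t' \<ge> 0\<close> by simp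
    also have "\<dots> \<le> ?M * L * dist u w * (exp (a * t') / a)"
      using a g(2) by (intro mult_left_mono divide_right_mono) auto
    also have "\<dots> = (?M * L / a) * (dist u w * exp (a * t'))" by simp
    also have "?M * L \<le> 1/2 * a" by (simp add: a_def)
    then have "(?M * L / a) * (dist u w * exp (a * t')) \<le> 1/2 * (dist u w * exp (a * t'))"
      using a by (intro mult_right_mono) (auto simp: pos_divide_le_eq)
    finally have "exp (- a * t') * \<bar>smear (h u) t' - smear (h w) t'\<bar> \<le> 1/2 * dist u w"
      by (simp add: exp_minus field_simps)
    then show "dist (Bcontfun (\<Phi> u) t) (Bcontfun (\<Phi> w) t) \<le> 1/2 * dist u w"
      unfolding app unfolding \<Phi>_def t'_def[symmetric]
      by (simp add: dist_real_def abs_mult flip: right_diff_distrib)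
  qed
  then obtain u where u: "Bcontfun (\<Phi> u) = u"
    using banach_fix_type[of "1/2" "\<lambda>u. Bcontfun (\<Phi> u)"] by auto
  define v where "v t = exp (a * t) * u t" for t
  show ?thesis
  proof
    show "continuous_on UNIV v" unfolding v_def by (intro continuous_intros) auto
    fix t :: real assume "0 \<le> t"
    have "u t = \<Phi> u t" using app[of u] u by simp
    also have "\<dots> = exp (- a * t) * (\<psi> + smear (\<lambda>r. g (v r)) t)"
      using \<open>0 \<le> t\<close> by (simp add: \<Phi>_def h_def[abs_def] v_def)
    finally show "v t = \<psi> + smear (\<lambda>r. g (v r)) t"
      by (simp add: v_def exp_minus field_simps)
  qed
qed

text \<open>The constant \<open>K\<close> in the proof is the a priori bound from Gronwall's inequality, so truncating \<open>f\<close>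
  at \<open>K\<close> does not change the equation on \<open>{0..T}\<close>.\<close>

lemma integral_equation_exists_bounded_interval:
  assumes f: "continuous_on {0..} f" "local_lipschitz (UNIV :: real set) {0..} (\<lambda>_. f)"
    and pos: "\<And>x. 0 \<le> x \<Longrightarrow> 0 \<le> f x" and growth: "\<And>x. 0 \<le> x \<Longrightarrow> f x \<le> C + x"
    and "0 < \<psi>" "0 \<le> T"
  obtains v where "continuous_on UNIV v" "\<And>t. 0 \<le> t \<Longrightarrow> 0 \<le> v t"
    "\<And>t. 0 \<le> t \<Longrightarrow> t \<le> T \<Longrightarrow> v t = \<psi> + smear (\<lambda>r. f (v r)) t"
proof -
  let ?M = "measure \<mu> (space \<mu>)"
  have "0 \<le> C" using pos[of 0] growth[of 0] by auto
  define K where "K = 2 * (\<psi> + ?M * C * T) * exp ((2 * ?M + 1) * T)"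
  have "0 \<le> K" using \<open>0 < \<psi>\<close> \<open>0 \<le> C\<close> \<open>0 \<le> T\<close> by (simp add: K_def)
  \<comment> \<open>Clipping below at 0 keeps the argument in the domain of \<open>f\<close> and
    does not affect nonnegative solutions.\<close>
  define cl where "cl x = max 0 (min K x)" for x
  have cl: "cl x \<in> {0..K}" "\<bar>cl x - cl y\<bar> \<le> \<bar>x - y\<bar>" for x y
    using \<open>0 \<le> K\<close> by (auto simp: cl_def)
  obtain L where "L-lipschitz_on {0..K} f"
    using local_lipschitz_compact_implies_lipschitz[where X = "{0..K}" and T = "{0}" and f = "\<lambda>_. f"]
      local_lipschitz_subset[OF f(2), of "{0}" "{0..K}"] by auto
  then have L: "L \<ge> 0" "\<And>x y. x \<in> {0..K} \<Longrightarrow> y \<in> {0..K} \<Longrightarrow> \<bar>f x - f y\<bar> \<le> L * \<bar>x - y\<bar>"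
    by (auto simp: lipschitz_on_def dist_real_def)
  obtain B where B: "\<And>r. 0 \<le> r \<Longrightarrow> r \<le> K \<Longrightarrow> \<bar>f r\<bar> \<le> B"
    using continuous_on_halfline_bound[OF f(1), of K] by metis
  have g_lip: "\<bar>f (cl x) - f (cl y)\<bar> \<le> L * \<bar>x - y\<bar>" for x y
    using L(2)[OF cl(1) cl(1), of x y] mult_left_mono[OF cl(2) L(1), of x y] by linarith
  obtain v where v: "continuous_on UNIV v" "\<And>t. 0 \<le> t \<Longrightarrow> v t = \<psi> + smear (\<lambda>r. f (cl (v r))) t"
    using integral_equation_exists_bounded_Lipschitz[of "\<lambda>x. f (cl x)" L B \<psi>] g_lip L(1) B cl(1) by auto
  have gc: "continuous_on {0..} (\<lambda>r. f (cl (v r)))"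
    by (rule continuous_on_compose2[OF f(1)])
      (auto simp: cl_def intro!: continuous_intros continuous_on_subset[OF v(1)])
  have g0: "0 \<le> f (cl (v r))" for r using pos cl(1) by simp
  have vpos: "0 \<le> v t" if "0 \<le> t" for t
    using v(2)[OF that] smear_nonneg[OF gc g0, of t] \<open>0 < \<psi>\<close> by simp
  have "v t \<le> K" if t: "0 \<le> t" "t \<le> T" for t
  proof -
    have "v t \<le> 2 * (\<psi> + ?M * C * T) * exp ((2 * ?M + 1) * t)"
    proof (rule gronwall[where T = T and D = v])
      fix t assume t: "0 \<le> t" "t \<le> T"
      have "v t \<le> \<psi> + ?M * integral {0..t} (\<lambda>r. f (cl (v r)))"
        using v(2)[OF t(1)] smear_le[OF gc g0, of t] by simp
      \<comment> \<open>Clipping never increases a nonnegative value, so the truncated nonlinearity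
        obeys the same affine bound, and Gronwall's inequality returns the level \<open>K\<close>
        itself.\<close>
      moreover have "integral {0..t} (\<lambda>r. f (cl (v r))) \<le> integral {0..t} (\<lambda>r. C + v r)"
      proof (intro integral_le integrable_continuous_real continuous_intros continuous_on_subset[OF v(1)] continuous_on_subset[OF gc])
        show "f (cl (v r)) \<le> C + v r" if "r \<in> {0..t}" for r
        proof -
          have "f (cl (v r)) \<le> C + cl (v r)" using cl(1) by (intro growth) auto
          also have "cl (v r) \<le> v r" using vpos[of r] that by (auto simp: cl_def)
          finally show ?thesis by simp
        qed
      qed auto
      moreover have "integral {0..t} (\<lambda>r. C + v r) = C * t + integral {0..t} v"
        using t by (subst Henstock_Kurzweil_Integration.integral_add)
          (auto intro!: integrable_continuous_real continuous_on_subset[OF v(1)])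
      moreover have "C * t \<le> C * T" using t \<open>0 \<le> C\<close> by (intro mult_left_mono) auto
      ultimately have "v t \<le> \<psi> + ?M * (C * T + integral {0..t} v)"
        by (smt (verit) measure_nonneg mult_left_mono)
      then show "v t \<le> \<psi> + ?M * C * T + ?M * integral {0..t} v"
        by (simp add: algebra_simps)
    qed (use t \<open>0 < \<psi>\<close> \<open>0 \<le> C\<close> \<open>0 \<le> T\<close> in \<open>auto intro!: continuous_on_subset[OF v(1)]\<close>)
    also have "\<dots> \<le> K"
      unfolding K_def using t \<open>0 < \<psi>\<close> \<open>0 \<le> C\<close> \<open>0 \<le> T\<close> by (intro mult_left_mono) (auto intro!: mult_left_mono)
    finally show ?thesis .
  qed
  then have "v t = \<psi> + smear (\<lambda>r. f (v r)) t" if "0 \<le> t" "t \<le> T" for t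
    unfolding v(2)[OF that(1)] using that vpos
    by (intro arg_cong2[of _ _ _ _ "(+)"] refl smear_cong) (auto simp: cl_def)
  with v(1) vpos show ?thesis by (intro that[of v]) auto
qed

text \<open>By uniqueness the solutions on \<open>{0..n}\<close> agree on the smaller of any two
  such intervals, so at time \<open>t\<close> the one with index
  \<open>nat \<lceil>t\<rceil>\<close> can be taken.\<close>

lemma integral_equation_exists:
  assumes f: "continuous_on {0..} f" "local_lipschitz (UNIV :: real set) {0..} (\<lambda>_. f)"
    and pos: "\<And>x. 0 \<le> x \<Longrightarrow> 0 \<le> f x" and growth: "\<And>x. 0 \<le> x \<Longrightarrow> f x \<le> C + x"
    and "0 < \<psi>"
  obtains v where "continuous_on {0..} v" "\<And>t. 0 \<le> t \<Longrightarrow> 0 \<le> v t"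
    "\<And>t. 0 \<le> t \<Longrightarrow> v t = \<psi> + smear (\<lambda>r. f (v r)) t"
proof -
  have "\<exists>v. continuous_on UNIV v \<and> (\<forall>t\<ge>0. 0 \<le> v t) \<and>
      (\<forall>t. 0 \<le> t \<longrightarrow> t \<le> T \<longrightarrow> v t = \<psi> + smear (\<lambda>r. f (v r)) t)" if "0 \<le> T" for T
    using integral_equation_exists_bounded_interval[OF f pos growth \<open>0 < \<psi>\<close> that] by metis
  then have "\<exists>V. \<forall>n::nat. continuous_on UNIV (V n) \<and> (\<forall>t\<ge>0. 0 \<le> V n t) \<and>
      (\<forall>t. 0 \<le> t \<longrightarrow> t \<le> real n \<longrightarrow> V n t = \<psi> + smear (\<lambda>r. f (V n r)) t)"
    by (intro choice) simp
  then obtain V where V: "\<And>n::nat. continuous_on UNIV (V n)" "\<And>n t. 0 \<le> t \<Longrightarrow> 0 \<le> V n t"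
      "\<And>n t. 0 \<le> t \<Longrightarrow> t \<le> real n \<Longrightarrow> V n t = \<psi> + smear (\<lambda>r. f (V n r)) t"
    by metis
  have V0: "continuous_on {0..} (V n)" for n by (rule continuous_on_subset[OF V(1)]) auto
  define v where "v t = V (nat \<lceil>t\<rceil>) t" for t
  have v: "v t = V n t" if "0 \<le> t" "t \<le> real n" for n t
  proof -
    have "\<lceil>t\<rceil> \<le> int n" using that by (simp add: ceiling_le_iff)
    then have "t \<le> real (nat \<lceil>t\<rceil>)" "real (nat \<lceil>t\<rceil>) \<le> real n" using that by linarith+
    then show ?thesis
      unfolding v_def using that
      by (intro integral_equation_unique[OF f V0 V(2) V0 V(2), where T = "real (nat \<lceil>t\<rceil>)" and \<psi> = \<psi>] V(3)) auto
  qed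
  show ?thesis
  proof
    show "0 \<le> v t" if "0 \<le> t" for t using V(2)[OF that] by (simp add: v_def)
    show "v t = \<psi> + smear (\<lambda>r. f (v r)) t" if t: "0 \<le> t" for t
    proof -
      obtain n :: nat where n: "t \<le> real n" using real_arch_simple by blast
      have "v t = \<psi> + smear (\<lambda>r. f (V n r)) t" using v V(3) t n by simp
      also have "smear (\<lambda>r. f (V n r)) t = smear (\<lambda>r. f (v r)) t"
        using v[where n = n] n by (intro smear_cong) auto
      finally show ?thesis .
    qed
    show "continuous_on {0..} v"
      unfolding continuous_on_eq_continuous_within
    proof
      fix t :: real assume t: "t \<in> {0..}"
      \<comment> \<open>The unit margin makes \<open>V n\<close> coincide with \<open>v\<close> on a
        whole neighbourhood of \<open>t\<close> in the half-line.\<close>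
      obtain n :: nat where n: "t + 1 \<le> real n" using real_arch_simple by blast
      have "continuous (at t within {0..}) (V n)"
        using V0 t by (auto simp: continuous_on_eq_continuous_within)
      then show "continuous (at t within {0..}) v"
        by (rule continuous_transform_within[OF _ zero_less_one]) (use t n v[where n = n] in \<open>auto simp: dist_real_def\<close>)
    qed
  qed
qed

end

section \<open>Slowly varying functions\<close>

locale slowly_varying =
  fixes f :: "real \<Rightarrow> real"
  assumes cont: "continuous_on {0..} f"
    and pos: "\<And>x. 0 \<le> x \<Longrightarrow> 0 < f x"
    and slow: "\<And>c. 0 < c \<Longrightarrow> ((\<lambda>x. f (c * x) / f x) \<longlongrightarrow> 1) at_top"
begin

text \<open>The local part of the uniform convergence theorem. For continuous \<open>f\<close> the Baire category theorem
  yields an interval of shifts on which the convergence is uniform.\<close>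

lemma log_oscillation_small:
  assumes "\<epsilon> > 0"
  shows "\<exists>r>0. \<exists>P. \<forall>p\<ge>P. \<forall>u. \<bar>u\<bar> < r \<longrightarrow> \<bar>ln (f (exp (p + u))) - ln (f (exp p))\<bar> \<le> \<epsilon>"
proof -
  \<comment> \<open>In logarithmic coordinates multiplication becomes translation: slow variation
    says that \<open>g (p + u) - g p\<close> tends to 0 for each fixed \<open>u\<close>.\<close>
  define g where "g p = ln (f (exp p))" for p
  have fc: "continuous_on UNIV (\<lambda>p. f (exp p))"
    by (intro continuous_on_compose2[OF cont] continuous_intros) auto
  have gc: "continuous_on UNIV g"
    unfolding g_def using pos[of "exp _"] by (intro continuous_on_ln fc) (auto simp: less_le)
  have g_lim: "((\<lambda>p. g (p + u) - g p) \<longlongrightarrow> 0) at_top" for u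
  proof -
    have "((\<lambda>p. f (exp u * exp p) / f (exp p)) \<longlongrightarrow> 1) at_top"
      by (rule filterlim_compose[OF slow exp_at_top]) simp
    then have "((\<lambda>p. ln (f (exp u * exp p) / f (exp p))) \<longlongrightarrow> ln 1) at_top"
      by (intro tendsto_ln) auto
    moreover have "ln (f (exp u * exp p) / f (exp p)) = g (p + u) - g p" for p
      using pos[of "exp u * exp p"] pos[of "exp p"]
      by (simp add: g_def exp_add ln_div mult.commute)
    ultimately show ?thesis by simp
  qed
  \<comment> \<open>\<open>A n\<close> collects the shifts for which the tolerance is met from
    \<open>n\<close> on. These sets are closed by continuity and cover the line, so one of them has
    interior points.\<close>
  define A where "A n = (\<Inter>p\<in>{real n..}. {u. \<bar>g (p + u) - g p\<bar> \<le> \<epsilon> / 2})" for n :: nat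
  have A_closed: "closed (A n)" for n
    unfolding A_def
    by (intro closed_INT ballI closed_Collect_le continuous_intros continuous_on_compose2[OF gc]) auto
  have A_cover: "\<exists>n. u \<in> A n" for u
  proof -
    have "eventually (\<lambda>p. \<bar>g (p + u) - g p\<bar> < \<epsilon> / 2) at_top"
      using tendstoD[OF g_lim[of u], of "\<epsilon> / 2"] assms by (simp add: dist_real_def)
    then obtain N where N: "\<And>p. p \<ge> N \<Longrightarrow> \<bar>g (p + u) - g p\<bar> < \<epsilon> / 2"
      by (auto simp: eventually_at_top_linorder)
    obtain n :: nat where "N \<le> real n" using real_arch_simple by blast
    then have "u \<in> A n" using N by (force simp: A_def intro: less_imp_le)
    then show ?thesis ..
  qed
  have "\<exists>n. interior (A n) \<noteq> {}"
  proof (rule ccontr)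
    assume "\<nexists>n. interior (A n) \<noteq> {}"
    then have "UNIV \<subseteq> closure (\<Inter>(range (\<lambda>n. - A n)))"
      using A_closed by (intro Baire) (auto simp: closure_complement open_closed)
    moreover have "\<Inter>(range (\<lambda>n. - A n)) = {}" using A_cover by auto
    ultimately show False by simp
  qed
  then obtain n c r where r: "r > 0" "ball c r \<subseteq> A n"
    by (meson equals0I mem_interior)
  show ?thesis
  \<comment> \<open>The shift \<open>u\<close> is the difference of the admissible shifts
    \<open>c + u\<close> and \<open>c\<close>, both taken from the base point \<open>p - c\<close>;
    hence the two halves of \<epsilon> and the threshold \<open>real n + c\<close>.\<close>
  proof (rule exI[of _ r], rule conjI[OF r(1)], rule exI[of _ "real n + c"], intro allI impI)
    fix p u assume *: "real n + c \<le> p" "\<bar>u\<bar> < r"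
    have "c + u \<in> A n" "c \<in> A n" using r * by (auto simp: dist_real_def)
    moreover have "p - c \<in> {real n..}" using * by auto
    ultimately have "\<bar>g (p - c + (c + u)) - g (p - c)\<bar> \<le> \<epsilon> / 2" "\<bar>g (p - c + c) - g (p - c)\<bar> \<le> \<epsilon> / 2"
      unfolding A_def by blast+
    then have "\<bar>g (p + u) - g (p - c)\<bar> \<le> \<epsilon> / 2" "\<bar>g p - g (p - c)\<bar> \<le> \<epsilon> / 2" by simp_all
    then have "\<bar>g (p + u) - g p\<bar> \<le> \<epsilon>" by linarith
    then show "\<bar>ln (f (exp (p + u))) - ln (f (exp p))\<bar> \<le> \<epsilon>" by (simp add: g_def)
  qed
qed

text \<open>On the logarithmic scale the quotient \<open>x t / y t\<close> is a variable shift
  tending to 0, which the locally uniform estimate covers.\<close>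

lemma asymptotic_equivalence_preserved:
  assumes y: "filterlim y at_top F" and xy: "((\<lambda>t. x t / y t) \<longlongrightarrow> 1) F"
  shows "((\<lambda>t. f (x t) / f (y t)) \<longlongrightarrow> 1) F"
proof -
  have y0: "eventually (\<lambda>t. 0 < y t) F" using y by (auto simp: filterlim_at_top_dense)
  have "eventually (\<lambda>t. 0 < x t / y t) F" using order_tendstoD(1)[OF xy, of 0] by simp
  with y0 have x0: "eventually (\<lambda>t. 0 < x t) F"
    by eventually_elim (simp add: zero_less_divide_iff)
  have ln_xy: "((\<lambda>t. ln (x t / y t)) \<longlongrightarrow> 0) F"
    using tendsto_ln[OF xy] by simp
  have ln_y: "filterlim (\<lambda>t. ln (y t)) at_top F"
    by (rule filterlim_compose[OF ln_at_top y])
  have "((\<lambda>t. ln (f (x t)) - ln (f (y t))) \<longlongrightarrow> 0) F"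
  proof (rule tendstoI)
    fix e :: real assume "e > 0"
    then obtain r P where r: "r > 0" and
      P: "\<And>p u. p \<ge> P \<Longrightarrow> \<bar>u\<bar> < r \<Longrightarrow> \<bar>ln (f (exp (p + u))) - ln (f (exp p))\<bar> \<le> e / 2"
      using log_oscillation_small[of "e / 2"] by auto
    have "eventually (\<lambda>t. \<bar>ln (x t / y t)\<bar> < r) F"
      using tendstoD[OF ln_xy r] by (simp add: dist_real_def)
    moreover have "eventually (\<lambda>t. P \<le> ln (y t)) F"
      using ln_y by (simp add: filterlim_at_top)
    ultimately show "eventually (\<lambda>t. dist (ln (f (x t)) - ln (f (y t))) 0 < e) F"
      using x0 y0
    proof eventually_elim
      case (elim t)
      have "exp (ln (y t) + ln (x t / y t)) = x t"
        using elim by (simp add: exp_add)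
      then show ?case using P[OF elim(2,1)] elim \<open>e > 0\<close> by (simp add: dist_real_def)
    qed
  qed
  then have "((\<lambda>t. exp (ln (f (x t)) - ln (f (y t)))) \<longlongrightarrow> exp 0) F"
    by (rule tendsto_exp)
  moreover have "eventually (\<lambda>t. exp (ln (f (x t)) - ln (f (y t))) = f (x t) / f (y t)) F"
    using x0 y0
  proof eventually_elim
    case (elim t)
    then show ?case using pos[of "x t"] pos[of "y t"] by (simp add: exp_diff)
  qed
  ultimately show ?thesis by (simp add: tendsto_cong)
qed

text \<open>Doubling the argument eventually multiplies \<open>f\<close> by less than 3/2, so
  \<open>f x / x\<close> shrinks at least by the factor 3/4. Any bound strictly between 1 and 2
  would serve in place of 3/2; dyadic iteration gives the decay.\<close>

lemma sublinear: "((\<lambda>x. f x / x) \<longlongrightarrow> 0) at_top"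
proof -
  have "eventually (\<lambda>x. f (2 * x) / f x < 3 / 2) at_top"
    using order_tendstoD(2)[OF slow[of 2], of "3/2"] by simp
  then obtain X0 where X0: "\<And>x. x \<ge> X0 \<Longrightarrow> f (2 * x) / f x < 3 / 2"
    by (auto simp: eventually_at_top_linorder)
  define X where "X = max 1 X0"
  have X: "X > 0" by (simp add: X_def)
  define h where "h x = f x / x" for x
  have h0: "0 < h x" if "x \<ge> X" for x using that X pos[of x] by (simp add: h_def)
  have step: "h x \<le> 3 / 4 * h (x / 2)" if "x \<ge> 2 * X" for x
  proof -
    have "f (2 * (x / 2)) / f (x / 2) < 3 / 2" using that by (intro X0) (auto simp: X_def)
    then have "f x \<le> 3 / 2 * f (x / 2)" using pos[of "x / 2"] that X by (simp add: field_simps)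
    then show ?thesis using that X by (simp add: h_def field_simps)
  qed
  obtain B where B: "B > 0" "\<And>x. 0 \<le> x \<Longrightarrow> x \<le> 2 * X \<Longrightarrow> \<bar>f x\<bar> \<le> B"
    using continuous_on_halfline_bound[OF cont, of "2 * X"] by metis
  \<comment> \<open>Repeated halving reaches the compact interval from \<open>X\<close> to
    \<open>2 * X\<close>, where \<open>f\<close> is at most \<open>B\<close>; by \<open>step\<close>
    the quotient \<open>h\<close> does not grow on the way back.\<close>
  have base: "h x \<le> B / X" if "X \<le> x" "x \<le> 2 ^ n * X" for n x
    using that
  proof (induction n arbitrary: x)
    case 0
    then show ?case using B(2)[of x] X by (auto simp: h_def divide_right_mono)
  next
    case (Suc n)
    show ?case
    proof (cases "x \<le> 2 * X")
      case True
      then show ?thesis using B(2)[of x] B(1) X Suc.prems by (auto simp: h_def intro!: frac_le)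
    next
      case False
      then have "h (x / 2) \<le> B / X" using Suc by (intro Suc.IH) auto
      then show ?thesis using step[of x] h0[of "x/2"] False by linarith
    qed
  qed
  have decay: "h x \<le> B / X * (3 / 4) ^ n" if "2 ^ n * X \<le> x" for n x
    using that
  proof (induction n arbitrary: x)
    case 0
    \<comment> \<open>The exponent depends on \<open>x\<close>, but the resulting bound
      \<open>B / X\<close> does not.\<close>
    obtain n where "x / X < 2 ^ n" using real_arch_pow[of 2 "x / X"] by auto
    then show ?case using base[of x n] 0 X by (simp add: field_simps)
  next
    case (Suc n)
    have "1 * X \<le> 2 ^ n * X" using X by (intro mult_right_mono) auto
    then have "h x \<le> 3 / 4 * h (x / 2)" using Suc.prems by (intro step) simp
    also have "h (x / 2) \<le> B / X * (3 / 4) ^ n" using Suc.prems by (intro Suc.IH) simp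
    finally show ?case by simp
  qed
  show ?thesis
  proof (rule tendstoI)
    fix e :: real assume "e > 0"
    have "(\<lambda>n. B / X * (3 / 4) ^ n) \<longlonglongrightarrow> 0"
      by (intro tendsto_mult_right_zero LIMSEQ_power_zero) auto
    then have "eventually (\<lambda>n. B / X * (3 / 4) ^ n < e) sequentially"
      using \<open>e > 0\<close> order_tendstoD(2) by blast
    then obtain n where n: "B / X * (3 / 4) ^ n < e" by (auto simp: eventually_sequentially)
    show "eventually (\<lambda>x. dist (f x / x) 0 < e) at_top"
      using eventually_ge_at_top[of "2 ^ n * X"] eventually_ge_at_top[of X]
    proof eventually_elim
      case (elim x)
      then show ?case using decay[of n x] n h0[of x] by (simp add: h_def)
    qed
  qed
qed

text \<open>Used with \<open>\<eta> = 1\<close> for the a priori bound and for the divergence of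
  \<open>recip_integral f\<close>, and with small \<eta> to control the increments of
  \<open>W\<close>.\<close>

lemma affine_bound:
  assumes "\<eta> > 0"
  obtains C where "C > 0" "\<And>x. 0 \<le> x \<Longrightarrow> f x \<le> C + \<eta> * x"
proof -
  have "eventually (\<lambda>x. f x / x < \<eta>) at_top"
    using order_tendstoD(2)[OF sublinear assms] .
  then obtain X where X: "\<And>x. x \<ge> X \<Longrightarrow> f x / x < \<eta>"
    by (auto simp: eventually_at_top_linorder)
  obtain B where B: "B > 0" "\<And>x. 0 \<le> x \<Longrightarrow> x \<le> max 1 X \<Longrightarrow> \<bar>f x\<bar> \<le> B"
    using continuous_on_halfline_bound[OF cont, of "max 1 X"] by metis
  show ?thesis
  proof (rule that[OF B(1)])
    fix x :: real assume "0 \<le> x"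
    show "f x \<le> B + \<eta> * x"
    proof (cases "x \<le> max 1 X")
      case True
      then have "f x \<le> B" "0 \<le> \<eta> * x" using B(2)[of x] \<open>0 \<le> x\<close> assms by auto
      then show ?thesis by linarith
    next
      case False
      then have "f x < \<eta> * x" using X[of x] by (simp add: field_simps)
      then show ?thesis using B(1) by simp
    qed
  qed
qed

section \<open>The primitive of \<open>1 / f\<close> and its inverse\<close>

lemma DERIV_recip_integral:
  assumes "0 < x"
  shows "(recip_integral f has_real_derivative 1 / f x) (at x)"
proof -
  have "((\<lambda>u. LBINT y=ereal 1..ereal u. 1 / f y) has_vector_derivative 1 / f x) (at x within {0..max 1 x + 1})"
    using assms pos
    by (intro interval_integral_FTC2 continuous_on_divide continuous_on_const continuous_on_subset[OF cont]) (auto simp: less_le)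
  moreover have "at x within {0..max 1 x + 1} = at x"
    using assms by (intro at_within_Icc_at) auto
  ultimately show ?thesis
    by (simp add: has_real_derivative_iff_has_vector_derivative recip_integral_def[abs_def] one_ereal_def)
qed

lemma recip_integral_1 [simp]: "recip_integral f 1 = 0"
  by (simp add: recip_integral_def one_ereal_def)

lemma recip_integral_strict_mono:
  assumes "0 < x" "x < y"
  shows "recip_integral f x < recip_integral f y"
proof (rule DERIV_pos_imp_increasing[OF assms(2)])
  show "\<exists>d. (recip_integral f has_real_derivative d) (at z) \<and> 0 < d" if "x \<le> z" "z \<le> y" for z
    using DERIV_recip_integral[of z] pos[of z] assms that by (intro exI[of _ "1 / f z"]) auto
qed

text \<open>An affine bound on \<open>f\<close> makes the primitive of \<open>1 / f\<close> grow at
  least like a logarithm.\<close>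

lemma recip_integral_at_top: "filterlim (recip_integral f) at_top at_top"
proof -
  obtain C where C: "C > 0" "\<And>x. 0 \<le> x \<Longrightarrow> f x \<le> C + 1 * x" using affine_bound[of 1] by auto
  have "ln (C + x) - ln (C + 1) \<le> recip_integral f x" if "1 \<le> x" for x
  proof -
    have "(recip_integral f 1 - ln (C + 1)) \<le> recip_integral f x - ln (C + x)"
    proof (rule DERIV_nonneg_imp_nondecreasing[OF that])
      fix z :: real assume z: "1 \<le> z" "z \<le> x"
      have "((\<lambda>x. recip_integral f x - ln (C + x)) has_real_derivative 1 / f z - 1 / (C + z)) (at z)"
        using z C(1) by (auto intro!: derivative_eq_intros DERIV_recip_integral)
      moreover have "1 / (C + z) \<le> 1 / f z" using z C pos[of z] by (intro divide_left_mono) (auto intro: mult_pos_pos)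
      ultimately show "\<exists>d. ((\<lambda>x. recip_integral f x - ln (C + x)) has_real_derivative d) (at z) \<and> 0 \<le> d"
        by (intro exI[of _ "1 / f z - 1 / (C + z)"]) auto
    qed
    then show ?thesis by simp
  qed
  moreover have "filterlim (\<lambda>x. - ln (C + 1) + ln (C + x)) at_top at_top"
    by (intro filterlim_tendsto_add_at_top[OF tendsto_const] filterlim_compose[OF ln_at_top] filterlim_ident)
  ultimately show ?thesis
    by (intro filterlim_at_top_mono[of _ at_top "recip_integral f"])
      (auto intro!: eventually_mono[OF eventually_ge_at_top[of 1]])
qed

text \<open>L'Hospital's rule reduces the quotient to \<open>c * f x / f (c * x)\<close>, to which
  slow variation applies directly.\<close>

lemma recip_integral_regularly_varying:
  assumes "0 < c"
  shows "((\<lambda>x. recip_integral f (c * x) / recip_integral f x) \<longlongrightarrow> c) at_top"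
proof (rule lhospital_at_top_at_top[OF recip_integral_at_top])
  show "eventually (\<lambda>x. ((\<lambda>x. recip_integral f (c * x)) has_real_derivative 1 / f (c * x) * c) (at x)) at_top"
    using eventually_gt_at_top[of 0]
  proof eventually_elim
    case (elim x)
    have "((*) c has_real_derivative c) (at x)" by (auto intro!: derivative_eq_intros)
    then show ?case using assms elim DERIV_chain2[where g = "(*) c" and f = "recip_integral f", OF DERIV_recip_integral] by simp
  qed
  show "eventually (\<lambda>x. (recip_integral f has_real_derivative 1 / f x) (at x)) at_top"
    using eventually_gt_at_top[of 0] by eventually_elim (rule DERIV_recip_integral)
  show "eventually (\<lambda>x. 1 / f x \<noteq> 0) at_top"
    using eventually_ge_at_top[of 0] by eventually_elim (use pos in \<open>force\<close>)
  have "((\<lambda>x. c * inverse (f (c * x) / f x)) \<longlongrightarrow> c * inverse 1) at_top"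
    by (intro tendsto_intros slow assms) auto
  then show "((\<lambda>x. (1 / f (c * x) * c) / (1 / f x)) \<longlongrightarrow> c) at_top"
    by (simp add: field_simps)
qed

text \<open>Since \<open>f\<close> is positive at 0, the primitive stays bounded near 0 and very
  negative values are not attained. From its value 0 at 1 it reaches every \<open>s \<ge> 0\<close>
  by the intermediate value theorem.\<close>

lemma recip_integral_inverse:
  assumes "0 \<le> s"
  shows "0 < the_inv_into {0<..} (recip_integral f) s"
    and "recip_integral f (the_inv_into {0<..} (recip_integral f) s) = s"
proof -
  have inj: "inj_on (recip_integral f) {0<..}"
    using recip_integral_strict_mono by (intro linorder_inj_onI) (auto simp: less_imp_neq)
  obtain b where b: "1 \<le> b" "s \<le> recip_integral f b"
  proof -
    have "eventually (\<lambda>b. 1 \<le> b \<and> s \<le> recip_integral f b) at_top"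
      using recip_integral_at_top unfolding filterlim_at_top by (intro eventually_conj eventually_ge_at_top) auto
    then show ?thesis using that by (auto simp: eventually_at_top_linorder)
  qed
  have "\<exists>x. 1 \<le> x \<and> x \<le> b \<and> recip_integral f x = s"
    using assms b by (intro IVT' continuous_at_imp_continuous_on ballI DERIV_isCont[OF DERIV_recip_integral]) auto
  then obtain x where x: "1 \<le> x" "recip_integral f x = s" by auto
  then have "the_inv_into {0<..} (recip_integral f) s = x"
    using the_inv_into_f_f[OF inj, of x] by simp
  with x show "0 < the_inv_into {0<..} (recip_integral f) s"
    "recip_integral f (the_inv_into {0<..} (recip_integral f) s) = s" by auto
qed

end

section \<open>Growth of the solution\<close>

locale delay_equation = delay_measure \<mu> + slowly_varying f
  for \<mu> :: "real measure" and f :: "real \<Rightarrow> real" +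
  fixes v :: "real \<Rightarrow> real" and c \<psi> :: real
  assumes mass_pos: "0 < measure \<mu> (space \<mu>)"
    and c: "0 < c" "\<And>x. 0 \<le> x \<Longrightarrow> c \<le> f x"
    and v_cont: "continuous_on {0..} v"
    and v_nonneg: "\<And>t. 0 \<le> t \<Longrightarrow> 0 \<le> v t"
    and v_eq: "\<And>t. 0 \<le> t \<Longrightarrow> v t = \<psi> + smear (\<lambda>r. f (v r)) t"
begin

abbreviation M :: real where "M \<equiv> measure \<mu> (space \<mu>)"

definition W :: "real \<Rightarrow> real" where "W t = integral {0..t} (\<lambda>r. f (v r))"

lemma fv_cont: "continuous_on {0..} (\<lambda>r. f (v r))"
  by (rule continuous_on_comp_nonneg[OF cont v_cont v_nonneg])

lemma fv_nonneg: "0 \<le> r \<Longrightarrow> 0 \<le> f (v r)"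
  using pos[of "v r"] v_nonneg[of r] by simp

lemma fv_integrable: "0 \<le> a \<Longrightarrow> (\<lambda>r. f (v r)) integrable_on {a..b}"
  by (intro integrable_continuous_real continuous_on_subset[OF fv_cont]) auto

lemma W_ge: "0 \<le> t \<Longrightarrow> c * t \<le> W t"
  unfolding W_def using integral_le[of "\<lambda>_. c" "{0..t}" "\<lambda>r. f (v r)"] c v_nonneg fv_integrable[of 0 t]
  by (auto simp: mult.commute)

lemma W_at_top: "filterlim W at_top at_top"
proof (rule filterlim_at_top_mono)
  show "filterlim (\<lambda>t. c * t) at_top at_top"
    by (intro filterlim_tendsto_pos_mult_at_top[OF tendsto_const] c filterlim_ident)
  show "eventually (\<lambda>t. c * t \<le> W t) at_top"
    using eventually_ge_at_top[of 0] by eventually_elim (rule W_ge)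
qed

lemma W_mono: "0 \<le> s \<Longrightarrow> s \<le> t \<Longrightarrow> W s \<le> W t"
  unfolding W_def using fv_nonneg by (intro integral_subset_le fv_integrable) auto

lemma W_diff: "0 \<le> s \<Longrightarrow> s \<le> t \<Longrightarrow> W t - W s = integral {s..t} (\<lambda>r. f (v r))"
  unfolding W_def
  using Henstock_Kurzweil_Integration.integral_combine[of 0 s t "\<lambda>r. f (v r)"] fv_integrable[of 0 t] by simp

lemma v_le: "0 \<le> t \<Longrightarrow> v t \<le> \<psi> + M * W t"
  using v_eq[of t] smear_le[OF fv_cont fv_nonneg, of t] by (simp add: W_def)

lemma v_ge: "0 \<le> a \<Longrightarrow> 0 \<le> t \<Longrightarrow> \<psi> + measure \<mu> {0..a} * W (t - a) \<le> v t"
  using v_eq[of t] smear_ge[OF fv_cont fv_nonneg, of a t] by (simp add: W_def)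

lemma inverse_W: "((\<lambda>t. C / W t) \<longlongrightarrow> 0) at_top"
  by (rule real_tendsto_divide_at_top[OF tendsto_const W_at_top])

text \<open>The increment over a window of length \<open>a\<close> is at most \<open>a\<close> times
  a bound for \<open>f (v r)\<close> there. As \<open>v r \<le> \<psi> + M * W t\<close> on the
  window, an affine bound of small slope makes the increment a constant plus a small multiple of
  \<open>W t\<close>.\<close>

lemma W_shift:
  assumes "0 \<le> a"
  shows "((\<lambda>t. W (t - a) / W t) \<longlongrightarrow> 1) at_top"
proof (rule tendstoI)
  fix e :: real assume "e > 0"
  \<comment> \<open>Chosen so that \<open>a * M * \<eta>\<close>, the limit of the bound on the
    relative increment, stays below \<open>e\<close>; the \<open>+ 1\<close> avoids a zero
    denominator.\<close>
  define \<eta> where "\<eta> = e / 2 / (a * M + 1)"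
  have aM: "0 \<le> a * M" using assms by simp
  then have "a * M + 1 > 0" by linarith
  then have "\<eta> > 0" unfolding \<eta>_def using \<open>e > 0\<close> by (intro divide_pos_pos) auto
  have "a * M * \<eta> \<le> (a * M + 1) * \<eta>" using \<open>\<eta> > 0\<close> by simp
  also have "\<dots> = e / 2"
    unfolding \<eta>_def using \<open>a * M + 1 > 0\<close>
    by (metis less_irrefl nonzero_mult_div_cancel_left times_divide_eq_right)
  finally have \<eta>: "a * M * \<eta> < e" using \<open>e > 0\<close> by simp
  obtain C where C: "C > 0" "\<And>x. 0 \<le> x \<Longrightarrow> f x \<le> C + \<eta> * x" using affine_bound[OF \<open>\<eta> > 0\<close>] by blast
  have "((\<lambda>t. a * (C + \<eta> * \<psi>) / W t + a * M * \<eta>) \<longlongrightarrow> 0 + a * M * \<eta>) at_top"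
    by (intro tendsto_intros inverse_W)
  then have "eventually (\<lambda>t. a * (C + \<eta> * \<psi>) / W t + a * M * \<eta> < e) at_top"
    using \<eta> by (intro order_tendstoD(2)) auto
  moreover have "eventually (\<lambda>t. 0 < W t) at_top"
    using W_at_top by (auto simp: filterlim_at_top_dense)
  ultimately show "eventually (\<lambda>t. dist (W (t - a) / W t) 1 < e) at_top"
    using eventually_ge_at_top[of a]
  proof eventually_elim
    case (elim t)
    have "W t - W (t - a) = integral {t - a..t} (\<lambda>r. f (v r))"
      using assms elim by (intro W_diff) auto
    also have "\<dots> \<le> integral {t - a..t} (\<lambda>r. C + \<eta> * (\<psi> + M * W t))"
    proof (intro integral_le fv_integrable)
      fix r assume r: "r \<in> {t - a..t}"
      then have "0 \<le> r" using elim by auto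
      have "M * W r \<le> M * W t" using \<open>0 \<le> r\<close> r by (intro mult_left_mono W_mono) auto
      then have "v r \<le> \<psi> + M * W t" using v_le[OF \<open>0 \<le> r\<close>] by linarith
      then have "C + \<eta> * v r \<le> C + \<eta> * (\<psi> + M * W t)" using \<open>\<eta> > 0\<close> by simp
      with C(2)[OF v_nonneg[OF \<open>0 \<le> r\<close>]] show "f (v r) \<le> C + \<eta> * (\<psi> + M * W t)" by linarith
    qed (use elim in auto)
    also have "\<dots> = a * (C + \<eta> * (\<psi> + M * W t))" using assms by simp
    finally have "(W t - W (t - a)) / W t \<le> a * (C + \<eta> * (\<psi> + M * W t)) / W t"
      using elim by (intro divide_right_mono) auto
    also have "\<dots> = a * (C + \<eta> * \<psi>) / W t + a * M * \<eta>"
      using elim by (simp add: field_simps)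
    finally have "(W t - W (t - a)) / W t < e" using elim by simp
    moreover have "W (t - a) \<le> W t" using elim assms by (intro W_mono) auto
    ultimately show ?case using elim by (simp add: dist_real_def diff_divide_distrib)
  qed
qed

lemma mass_tail:
  assumes "l < M"
  obtains a where "0 \<le> a" "l < measure \<mu> {0..a}"
proof -
  have "(\<lambda>n. measure \<mu> {0..real n}) \<longlonglongrightarrow> measure \<mu> (\<Union>n. {0..real n})"
    by (rule finite_Lim_measure_incseq) (auto simp: incseq_def)
  also have "(\<Union>n. {0..real n}) = space \<mu>"
    using real_arch_simple by (auto simp: space_eq)
  finally have "eventually (\<lambda>n. l < measure \<mu> {0..real n}) sequentially"
    using assms by (rule order_tendstoD(1))
  then obtain n :: nat where "l < measure \<mu> {0..real n}" by (auto simp: eventually_sequentially)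
  then show ?thesis by (intro that[of "real n"]) auto
qed

text \<open>For the lower bound \<open>a\<close> is fixed first, with more than \<open>l\<close> of
  the mass in \<open>{0..a}\<close>; only then does \<open>t\<close> tend to infinity, where
  \<open>W_shift\<close> removes the fixed shift.\<close>

lemma v_over_W: "((\<lambda>t. v t / W t) \<longlongrightarrow> M) at_top"
proof (rule order_tendstoI)
  have W0: "eventually (\<lambda>t. 0 < W t) at_top"
    using W_at_top by (auto simp: filterlim_at_top_dense)
  {
    fix u assume "M < u"
    have "((\<lambda>t. \<psi> / W t + M) \<longlongrightarrow> 0 + M) at_top" by (intro tendsto_intros inverse_W)
    then have "eventually (\<lambda>t. \<psi> / W t + M < u) at_top" using \<open>M < u\<close> by (intro order_tendstoD(2)) auto
    with W0 eventually_ge_at_top[of 0] show "eventually (\<lambda>t. v t / W t < u) at_top"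
    proof eventually_elim
      case (elim t)
      have "v t / W t \<le> (\<psi> + M * W t) / W t" using elim v_le[of t] by (intro divide_right_mono) auto
      then show ?case using elim by (simp add: add_divide_distrib)
    qed
  next
    fix l assume "l < M"
    then obtain a where a: "0 \<le> a" "l < measure \<mu> {0..a}" by (rule mass_tail)
    have "((\<lambda>t. \<psi> / W t + measure \<mu> {0..a} * (W (t - a) / W t)) \<longlongrightarrow> 0 + measure \<mu> {0..a} * 1) at_top"
      by (intro tendsto_intros inverse_W W_shift a)
    then have "eventually (\<lambda>t. l < \<psi> / W t + measure \<mu> {0..a} * (W (t - a) / W t)) at_top"
      using a by (intro order_tendstoD(1)) auto
    with W0 eventually_ge_at_top[of 0] show "eventually (\<lambda>t. l < v t / W t) at_top"
    proof eventually_elim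
      case (elim t)
      have "(\<psi> + measure \<mu> {0..a} * W (t - a)) / W t \<le> v t / W t"
        using elim a v_ge[of a t] by (intro divide_right_mono) auto
      then show ?case using elim by (simp add: add_divide_distrib)
    qed
  }
qed

lemma v_asymp: "((\<lambda>t. v t / (M * W t)) \<longlongrightarrow> 1) at_top"
proof -
  have "((\<lambda>t. (v t / W t) / M) \<longlongrightarrow> M / M) at_top"
    using mass_pos by (intro tendsto_divide v_over_W tendsto_const) auto
  then show ?thesis using mass_pos by (simp add: mult.commute)
qed

lemma MW_at_top: "filterlim (\<lambda>t. M * W t) at_top at_top"
  by (rule filterlim_tendsto_pos_mult_at_top[OF tendsto_const mass_pos W_at_top])

lemma v_at_top: "filterlim v at_top at_top"
proof -
  have "filterlim (\<lambda>t. v t / W t * W t) at_top at_top"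
    by (rule filterlim_tendsto_pos_mult_at_top[OF v_over_W mass_pos W_at_top])
  moreover have "eventually (\<lambda>t. 0 < W t) at_top"
    using W_at_top by (auto simp: filterlim_at_top_dense)
  then have "eventually (\<lambda>t. v t / W t * W t = v t) at_top"
    by eventually_elim simp
  ultimately show ?thesis by (simp only: filterlim_cong[OF refl refl])
qed

section \<open>Passage to the inverse of \<open>F\<close>\<close>

lemma recip_integral_MW: "((\<lambda>t. recip_integral f (M * W t) / t) \<longlongrightarrow> M) at_top"
proof (rule lhospital_at_top_at_top[where g' = "\<lambda>_. 1"])
  show "eventually (\<lambda>t. ((\<lambda>t. recip_integral f (M * W t)) has_real_derivative
      1 / f (M * W t) * (M * f (v t))) (at t)) at_top"
    using eventually_gt_at_top[of 0]
  proof eventually_elim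
    case (elim t)
    have "0 < M * W t" using W_ge[of t] elim c mass_pos by (smt (verit) mult_pos_pos)
    moreover have "((\<lambda>t. M * W t) has_real_derivative M * f (v t)) (at t)"
      unfolding W_def by (intro DERIV_cmult has_real_derivative_integral_from_0 fv_cont elim)
    ultimately show ?case
      using DERIV_chain2[where g = "\<lambda>t. M * W t" and f = "recip_integral f", OF DERIV_recip_integral] by simp
  qed
  \<comment> \<open>The uniform estimate enters here, comparing the arguments \<open>v t\<close> and
    \<open>M * W t\<close>.\<close>
  have "((\<lambda>t. M * (f (v t) / f (M * W t))) \<longlongrightarrow> M * 1) at_top"
    by (intro tendsto_intros asymptotic_equivalence_preserved MW_at_top v_asymp)
  then show "((\<lambda>t. 1 / f (M * W t) * (M * f (v t)) / 1) \<longlongrightarrow> M) at_top" by simp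
qed (auto intro: filterlim_ident)

text \<open>A factor \<open>a\<close> different from 1 moves the limit away from \<open>M\<close>;
  the comparison with \<open>M * t\<close> rests on this strict gap.\<close>

lemma recip_integral_scaled_MW:
  assumes "0 < a"
  shows "((\<lambda>t. recip_integral f (a * (M * W t)) / t) \<longlongrightarrow> a * M) at_top"
proof -
  have "((\<lambda>t. recip_integral f (a * (M * W t)) / recip_integral f (M * W t) *
      (recip_integral f (M * W t) / t)) \<longlongrightarrow> a * M) at_top"
    by (intro tendsto_mult recip_integral_MW filterlim_compose[OF recip_integral_regularly_varying[OF assms] MW_at_top])
  moreover have "eventually (\<lambda>t. recip_integral f (M * W t) > 0) at_top"
    using filterlim_compose[OF recip_integral_at_top MW_at_top] by (auto simp: filterlim_at_top_dense)
  then have "eventually (\<lambda>t. recip_integral f (a * (M * W t)) / recip_integral f (M * W t) *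
      (recip_integral f (M * W t) / t) = recip_integral f (a * (M * W t)) / t) at_top"
    by eventually_elim simp
  ultimately show ?thesis by (simp only: tendsto_cong)
qed

text \<open>For \<open>u > 1\<close> the value of \<open>recip_integral f\<close> at
  \<open>u * (M * W t)\<close> eventually exceeds \<open>M * t\<close>, and strict monotonicity
  transfers this to the arguments; positive factors below 1 give the other side.\<close>

lemma inverse_asymp:
  "((\<lambda>t. the_inv_into {0<..} (recip_integral f) (M * t) / (M * W t)) \<longlongrightarrow> 1) at_top"
proof -
  let ?z = "\<lambda>t. the_inv_into {0<..} (recip_integral f) (M * t)"
  have z: "0 < ?z t" "recip_integral f (?z t) = M * t" if "0 \<le> t" for t
    using recip_integral_inverse[of "M * t"] that mass_pos by auto
  have MW0: "eventually (\<lambda>t. 0 < M * W t) at_top"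
    using MW_at_top by (auto simp: filterlim_at_top_dense)
  show ?thesis
  proof (rule order_tendstoI)
    fix u :: real assume u: "1 < u"
    then have "eventually (\<lambda>t. M < recip_integral f (u * (M * W t)) / t) at_top"
      using mass_pos by (intro order_tendstoD(1)[OF recip_integral_scaled_MW]) auto
    with MW0 eventually_gt_at_top[of 0] show "eventually (\<lambda>t. ?z t / (M * W t) < u) at_top"
    proof eventually_elim
      case (elim t)
      then have "recip_integral f (?z t) < recip_integral f (u * (M * W t))"
        using z[of t] by (simp add: field_simps)
      then have "?z t < u * (M * W t)"
        using recip_integral_strict_mono[of "u * (M * W t)" "?z t"] elim u
        by (smt (verit) mult_pos_pos)
      then show ?case using elim by (simp add: pos_divide_less_eq)
    qed
  next
    fix l :: real assume l: "l < 1"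
    show "eventually (\<lambda>t. l < ?z t / (M * W t)) at_top"
    proof (cases "0 < l")
      case True
      then have "eventually (\<lambda>t. recip_integral f (l * (M * W t)) / t < M) at_top"
        using mass_pos l by (intro order_tendstoD(2)[OF recip_integral_scaled_MW]) auto
      with MW0 eventually_gt_at_top[of 0] show ?thesis
      proof eventually_elim
        case (elim t)
        then have "recip_integral f (l * (M * W t)) < recip_integral f (?z t)"
          using z[of t] by (simp add: field_simps)
        then have "l * (M * W t) < ?z t"
          using recip_integral_strict_mono[of "?z t" "l * (M * W t)"] z[of t] elim
          by (smt (verit))
        then show ?case using elim by (simp add: pos_less_divide_eq)
      qed
    next
      \<comment> \<open>For \<open>l \<le> 0\<close> the argument \<open>l * (M * W t)\<close>
        leaves the domain of the comparison; positivity of the quotient suffices.\<close>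
      case False
      from MW0 eventually_gt_at_top[of 0] show ?thesis
      proof eventually_elim
        case (elim t)
        then have "0 < ?z t / (M * W t)" using z[of t] by (intro divide_pos_pos) auto
        then show ?case using False by linarith
      qed
    qed
  qed
qed

lemma solution_asymp:
  "((\<lambda>t. v t / the_inv_into {0<..} (recip_integral f) (M * t)) \<longlongrightarrow> 1) at_top"
proof -
  let ?z = "\<lambda>t. the_inv_into {0<..} (recip_integral f) (M * t)"
  have "((\<lambda>t. (v t / (M * W t)) / (?z t / (M * W t))) \<longlongrightarrow> 1 / 1) at_top"
    by (intro tendsto_divide v_asymp inverse_asymp) auto
  moreover have "eventually (\<lambda>t. 0 < M * W t) at_top"
    using MW_at_top by (auto simp: filterlim_at_top_dense)
  then have "eventually (\<lambda>t. (v t / (M * W t)) / (?z t / (M * W t)) = v t / ?z t) at_top"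
  proof eventually_elim
    case (elim t)
    have "x / k / (y / k) = x / y" if "k \<noteq> 0" for x y k :: real using that by simp
    with elim show ?case by (metis less_irrefl)
  qed
  ultimately show ?thesis by (simp only: tendsto_cong div_by_1)
qed

end

theorem theorem15:
  fixes \<mu> :: "real measure" and f F :: "real \<Rightarrow> real" and M \<psi> :: real
  assumes mu_borel: "sets \<mu> = sets (restrict_space borel {0..})"
    and mu_total: "emeasure \<mu> {0..} = ennreal M" and M_pos: "0 < M"
    and f_cont: "continuous_on {0..} f"
    and f_pos: "\<forall>x\<ge>0. 0 < f x"
    and f_lipschitz: "local_lipschitz (UNIV :: real set) {0..} (\<lambda>_. f)"
    and f_rv: "regularly_varying f 0"
    and f_away: "0 < (INF x\<in>{0..}. f x)"
    and psi_pos: "0 < \<psi>"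
    and F_eq: "\<forall>x>0. F x = recip_integral f x"
  shows "\<exists>v. is_solution \<mu> f \<psi> v \<and>
             (\<forall>w. is_solution \<mu> f \<psi> w \<longrightarrow> (\<forall>t\<ge>0. w t = v t)) \<and>
             filterlim v at_top at_top \<and>
             ((\<lambda>t. v t / the_inv_into {0<..} F (M * t)) \<longlongrightarrow> 1) at_top"
proof -
  have space: "space \<mu> = {0..}"
    using sets_eq_imp_space_eq[OF mu_borel] by (simp add: space_restrict_space)
  interpret finite_measure \<mu>
    by (rule finite_measureI) (simp add: space mu_total)
  interpret delay_measure \<mu>
    by unfold_locales (rule mu_borel)
  have M: "measure \<mu> (space \<mu>) = M"
    using mu_total M_pos by (simp add: space measure_def)
  interpret slowly_varying f
  proof
    show "((\<lambda>x. f (c * x) / f x) \<longlongrightarrow> 1) at_top" if "0 < c" for c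
      using f_rv that by (auto simp: regularly_varying_def)
  qed (use f_cont f_pos in auto)
  \<comment> \<open>On the reals \<open>INF\<close> is known to be a lower bound only for a set
    bounded below; positivity of \<open>f\<close> provides this.\<close>
  have f_ge: "(INF x\<in>{0..}. f x) \<le> f x" if "0 \<le> x" for x
    using that f_pos by (intro cINF_lower bdd_belowI[of _ 0]) (auto intro: less_imp_le)
  obtain C where C: "C > 0" "\<And>x. 0 \<le> x \<Longrightarrow> f x \<le> C + 1 * x" using affine_bound[of 1] by auto
  obtain v where v: "continuous_on {0..} v" "\<And>t. 0 \<le> t \<Longrightarrow> 0 \<le> v t"
    "\<And>t. 0 \<le> t \<Longrightarrow> v t = \<psi> + smear (\<lambda>r. f (v r)) t"
    using integral_equation_exists[OF f_cont f_lipschitz, of C \<psi>] C f_pos psi_pos by (auto simp: less_imp_le)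
  interpret delay_equation \<mu> f v "INF x\<in>{0..}. f x" \<psi>
    by standard (use M M_pos f_away f_ge v in auto)
  have "is_solution \<mu> f \<psi> v" by (rule integral_equation_imp_is_solution[OF f_cont v])
  moreover have "w t = v t" if w: "is_solution \<mu> f \<psi> w" and "0 \<le> t" for w t
  proof (rule integral_equation_unique[OF f_cont f_lipschitz _ _ v(1,2) _ v(3) \<open>0 \<le> t\<close> order_refl])
    show "w t = \<psi> + smear (\<lambda>r. f (w r)) t" if "0 \<le> t" for t
      by (rule is_solution_imp_integral_equation[OF f_cont w that])
  qed (use w in \<open>auto simp: is_solution_def\<close>)
  \<comment> \<open>Agreement at positive arguments is enough, because \<open>the_inv_into\<close>
    looks for preimages in \<open>{0<..}\<close> alone.\<close>
  moreover have "the_inv_into {0<..} F s = the_inv_into {0<..} (recip_integral f) s" for s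
    using F_eq unfolding the_inv_into_def by (intro arg_cong[of _ _ The] ext) auto
  ultimately show ?thesis
    using v_at_top solution_asymp unfolding M by auto
qed

end
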